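(* Let $P$ be a special ample polytope and let $m \in \mathbb{Z}_{>0}$. Consider the dilated polytope $mP := \{mx : x \in P\}$. Then any point $z \in \Lambda(mP)$ can be written as a sum $z = z_1 + \cdots + z_m$ with $z_i \in \Lambda(P)$ for all $i = 1, \ldots, m$.
   Context: Let $\Phi$ be an irreducible, reduced (finite, crystallographic) root system of rank $n$, with set of roots $\Delta$. Let $Y \subseteq X$ be its root and weight lattices and $X^\vee \subseteq Y^\vee$ its coroot and coweight lattices. Let $\langle\,,\rangle : X \times X^\vee \to \mathbb{Z}$ be the usual pairing, extended to $(X\otimes_{\mathbb Z}\mathbb{R}) \times X^\vee \to \mathbb{R}$; for $\alpha\in\Delta$ let $\alpha^\vee$ be its coroot. Let $F$ be the Weyl fan in $Y^\vee \otimes_{\mathbb Z} \mathbb{R}$ (cut out by the root hyperplanes) and $F_n$ the set of its maximal cones (the Weyl chambers). For $\sigma\in F_n$ let $\{\alpha_{i,\sigma} : i \in I\}$, $I=\{1,\dots,n\}$, be the corresponding set of simple roots. An element $x \in X\otimes_{\mathbb Z}\mathbb{R}$ is $\sigma$-dominant if $\langle x, \alpha_{i,\sigma}^\vee\rangle \ge 0$ for all $i \in I$. For adjacent chambers $\sigma,\sigma'$ (sharing a common wall), $\alpha_{\sigma,\sigma'}\in\Delta$ is the unique root positive on $\sigma$ and negative on $\sigma'$. An ample polytope is a convex polytope $P \subset X\otimes_{\mathbb Z}\mathbb{R}$ whose vertices are given by a set $\{\mu_\sigma : \sigma\in F_n\} \subset X$ such that for any two adjacent chambers $\sigma,\sigma'$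 one has $\mu_\sigma - \mu_{\sigma'} = r_{\sigma,\sigma'}\,\alpha_{\sigma,\sigma'}$ for some $r_{\sigma,\sigma'} \in \mathbb{Z}_{>0}$. It is special if $\mu_\sigma$ is $\sigma$-dominant for every $\sigma\in F_n$. Put $\Lambda(P) := P \cap (\mu_\sigma + Y)$, which does not depend on the choice of $\sigma \in F_n$. The dilation $mP$ is a special ample polytope with vertices $m\mu_\sigma$. *)

theory Defs
  imports "HOL-Analysis.Analysis"
begin

text \<open>
  Root systems live in a Euclidean space \<open>'a\<close> whose inner product is invariant under the Weyl group.
  The space \<open>'a\<close> plays the role of \<open>X \<otimes> \<real>\<close>; its dual \<open>Y\<^sup>\<or> \<otimes> \<real>\<close> is identified with \<open>'a\<close> by means of
  the inner product, so that the pairing is \<open>x \<bullet> y\<close> and the coroots are again vectors of \<open>'a\<close>.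
\<close>

definition coroot :: "'a::euclidean_space \<Rightarrow> 'a" where
  "coroot \<alpha> = (2 / (\<alpha> \<bullet> \<alpha>)) *\<^sub>R \<alpha>"

definition root_reflection :: "'a::euclidean_space \<Rightarrow> 'a \<Rightarrow> 'a" where
  "root_reflection \<alpha> x = x - (x \<bullet> coroot \<alpha>) *\<^sub>R \<alpha>"

text \<open>The rank is \<open>DIM('a)\<close>, which is positive; hence \<open>\<Delta>\<close> is automatically nonempty.\<close>

definition root_system :: "'a::euclidean_space set \<Rightarrow> bool" where
  "root_system \<Delta> \<longleftrightarrow>
     finite \<Delta> \<and> 0 \<notin> \<Delta> \<and> span \<Delta> = UNIV \<and>
     (\<forall>\<alpha>\<in>\<Delta>. root_reflection \<alpha> ` \<Delta> = \<Delta>) \<and>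
     (\<forall>\<alpha>\<in>\<Delta>. \<forall>\<beta>\<in>\<Delta>. \<beta> \<bullet> coroot \<alpha> \<in> \<int>)"

definition reduced_roots :: "'a::euclidean_space set \<Rightarrow> bool" where
  "reduced_roots \<Delta> \<longleftrightarrow> (\<forall>\<alpha>\<in>\<Delta>. \<forall>c. c *\<^sub>R \<alpha> \<in> \<Delta> \<longrightarrow> c = 1 \<or> c = - 1)"

definition irreducible_roots :: "'a::euclidean_space set \<Rightarrow> bool" where
  "irreducible_roots \<Delta> \<longleftrightarrow> \<Delta> \<noteq> {} \<and>
     \<not> (\<exists>A B. A \<noteq> {} \<and> B \<noteq> {} \<and> A \<union> B = \<Delta> \<and> A \<inter> B = {} \<and>
            (\<forall>\<alpha>\<in>A. \<forall>\<beta>\<in>B. \<alpha> \<bullet> \<beta> = 0))"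

lemma module_int_scaleR: "module (\<lambda>(k::int) (x::'a::real_vector). of_int k *\<^sub>R x)"
  by unfold_locales (simp_all add: algebra_simps)

text \<open>The additive subgroup generated by a set, as a span over the integers.\<close>

definition int_span :: "'a::real_vector set \<Rightarrow> 'a set" where
  "int_span S = module.span (\<lambda>(k::int) x. of_int k *\<^sub>R x) S"

definition root_lattice :: "'a::euclidean_space set \<Rightarrow> 'a set" where
  "root_lattice \<Delta> = int_span \<Delta>"

definition coroot_lattice :: "'a::euclidean_space set \<Rightarrow> 'a set" where
  "coroot_lattice \<Delta> = int_span (coroot ` \<Delta>)"

definition weight_lattice :: "'a::euclidean_space set \<Rightarrow> 'a set" where
  "weight_lattice \<Delta> = {x. \<forall>y\<in>coroot_lattice \<Delta>. x \<bullet> y \<in> \<int>}"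

text \<open>Chambers are closed cones, being the maximal cones of the Weyl fan.\<close>

definition chambers :: "'a::euclidean_space set \<Rightarrow> 'a set set" where
  "chambers \<Delta> = closure ` components (UNIV - (\<Union>\<alpha>\<in>\<Delta>. {y. \<alpha> \<bullet> y = 0}))"

text \<open>A root has a constant sign on the interior of a chamber but may vanish on its boundary.\<close>

definition positive_on :: "'a::euclidean_space set \<Rightarrow> 'a \<Rightarrow> bool" where
  "positive_on \<sigma> \<alpha> \<longleftrightarrow> (\<forall>y\<in>interior \<sigma>. \<alpha> \<bullet> y > 0)"

definition negative_on :: "'a::euclidean_space set \<Rightarrow> 'a \<Rightarrow> bool" where
  "negative_on \<sigma> \<alpha> \<longleftrightarrow> (\<forall>y\<in>interior \<sigma>. \<alpha> \<bullet> y < 0)"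

definition positive_roots :: "'a::euclidean_space set \<Rightarrow> 'a set \<Rightarrow> 'a set" where
  "positive_roots \<Delta> \<sigma> = {\<alpha>\<in>\<Delta>. positive_on \<sigma> \<alpha>}"

definition simple_roots :: "'a::euclidean_space set \<Rightarrow> 'a set \<Rightarrow> 'a set" where
  "simple_roots \<Delta> \<sigma> =
     {\<alpha> \<in> positive_roots \<Delta> \<sigma>.
        \<not> (\<exists>\<beta>\<in>positive_roots \<Delta> \<sigma>. \<exists>\<gamma>\<in>positive_roots \<Delta> \<sigma>. \<alpha> = \<beta> + \<gamma>)}"

definition dominant :: "'a::euclidean_space set \<Rightarrow> 'a set \<Rightarrow> 'a \<Rightarrow> bool" where
  "dominant \<Delta> \<sigma> x \<longleftrightarrow> (\<forall>\<alpha>\<in>simple_roots \<Delta> \<sigma>. x \<bullet> coroot \<alpha> \<ge> 0)"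

definition adjacent :: "'a::euclidean_space set \<Rightarrow> 'a set \<Rightarrow> bool" where
  "adjacent \<sigma> \<sigma>' \<longleftrightarrow> \<sigma> \<noteq> \<sigma>' \<and> (\<exists>W. W facet_of \<sigma> \<and> W facet_of \<sigma>')"

definition wall_root :: "'a::euclidean_space set \<Rightarrow> 'a set \<Rightarrow> 'a set \<Rightarrow> 'a" where
  "wall_root \<Delta> \<sigma> \<sigma>' = (THE \<alpha>. \<alpha> \<in> \<Delta> \<and> positive_on \<sigma> \<alpha> \<and> negative_on \<sigma>' \<alpha>)"

text \<open>The family \<open>\<mu>\<close> of vertices, indexed by the chambers, is kept as an explicit parameter; its
  values outside \<open>chambers \<Delta>\<close> are irrelevant.\<close>

definition ample_polytope ::
  "'a::euclidean_space set \<Rightarrow> 'a set \<Rightarrow> ('a set \<Rightarrow> 'a) \<Rightarrow> bool" where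
  "ample_polytope \<Delta> P \<mu> \<longleftrightarrow>
     polytope P \<and> {x. x extreme_point_of P} = \<mu> ` chambers \<Delta> \<and>
     \<mu> ` chambers \<Delta> \<subseteq> weight_lattice \<Delta> \<and>
     (\<forall>\<sigma>\<in>chambers \<Delta>. \<forall>\<sigma>'\<in>chambers \<Delta>. adjacent \<sigma> \<sigma>' \<longrightarrow>
        (\<exists>r::int. r > 0 \<and> \<mu> \<sigma> - \<mu> \<sigma>' = of_int r *\<^sub>R wall_root \<Delta> \<sigma> \<sigma>'))"

definition special_ample_polytope ::
  "'a::euclidean_space set \<Rightarrow> 'a set \<Rightarrow> ('a set \<Rightarrow> 'a) \<Rightarrow> bool" where
  "special_ample_polytope \<Delta> P \<mu> \<longleftrightarrow>
     ample_polytope \<Delta> P \<mu> \<and> (\<forall>\<sigma>\<in>chambers \<Delta>. dominant \<Delta> \<sigma> (\<mu> \<sigma>))"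

text \<open>For an ample polytope this does not depend on the chamber \<open>\<sigma>\<close>.\<close>

definition Lambda ::
  "'a::euclidean_space set \<Rightarrow> 'a set \<Rightarrow> ('a set \<Rightarrow> 'a) \<Rightarrow> 'a set \<Rightarrow> 'a set" where
  "Lambda \<Delta> P \<mu> \<sigma> = P \<inter> (\<lambda>y. \<mu> \<sigma> + y) ` root_lattice \<Delta>"

end

theory Submission
  imports Defs
begin

text \<open>
  Choose a chamber \<open>\<tau>\<close> for which \<open>z\<close> is dominant, and write \<open>x \<le>\<^sub>\<rho> y\<close> if \<open>y - x\<close> is a sum of
  positive roots of \<open>\<rho>\<close>. Then \<open>z \<le>\<^sub>\<tau> m \<mu>\<^sub>\<tau>\<close>.

  Call a weight \<open>x\<close> near-dominant for \<open>\<tau>\<close> if \<open>\<langle>x, \<gamma>\<^sup>\<or>\<rangle> \<ge> - 1\<close> for all positive roots \<open>\<gamma>\<close> of \<open>\<tau>\<close>. If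
  \<open>x \<le>\<^sub>\<tau> \<mu>\<^sub>\<tau>\<close> is near-dominant, then \<open>x \<le>\<^sub>\<rho> \<mu>\<^sub>\<rho>\<close> for every chamber \<open>\<rho>\<close>, hence \<open>x \<in> P\<close>: along a
  gallery from \<open>\<tau>\<close> to \<open>\<rho>\<close>, crossing the wall of \<open>\<delta>\<close> can destroy the inequality only through a
  coefficient \<open>t\<close> of \<open>\<delta>\<close>, and dominance of the new vertex gives \<open>2 t \<le> 1\<close>, so \<open>t \<le> 0\<close> because
  \<open>t\<close> is an integer.

  It remains to write \<open>z\<close> as a sum of near-dominant \<open>w\<^sub>1, \<dots>, w\<^sub>m \<le>\<^sub>\<tau> \<mu>\<^sub>\<tau>\<close>. Take such a tuple with
  \<open>\<Sum> \<bar>w\<^sub>i\<bar>\<^sup>2\<close> minimal. If \<open>\<alpha>\<close> is simple and \<open>\<langle>w\<^sub>j, \<alpha>\<^sup>\<or>\<rangle> < 0\<close>, then \<open>\<langle>w\<^sub>k, \<alpha>\<^sup>\<or>\<rangle> > 0\<close> for some \<open>k\<close>, since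
  \<open>z\<close> is dominant, and replacing \<open>w\<^sub>j, w\<^sub>k\<close> by \<open>w\<^sub>j + \<alpha>, w\<^sub>k - \<alpha>\<close> shows by minimality that
  \<open>\<langle>w\<^sub>j, \<alpha>\<^sup>\<or>\<rangle> = - 1\<close> and that the new tuple, in which \<open>w\<^sub>j\<close> is reflected in \<open>\<alpha>\<close>, is again minimal.
  Induction on the height of \<open>\<gamma>\<close>, reflecting \<open>\<gamma>\<close> in a simple root \<open>\<alpha>\<close> with \<open>\<langle>\<gamma>, \<alpha>\<^sup>\<or>\<rangle> > 0\<close>, then bounds all
  pairings.
\<close>

section \<open>Roots and reflections\<close>

lemma inner_coroot: "x \<bullet> coroot \<alpha> = 2 * (x \<bullet> \<alpha>) / (\<alpha> \<bullet> \<alpha>)"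
  by (simp add: coroot_def)

lemma linear_root_reflection: "linear (root_reflection \<alpha>)"
  by (rule linearI) (simp_all add: root_reflection_def algebra_simps)

lemma root_reflection_inner:
  "root_reflection \<alpha> x \<bullet> y = x \<bullet> root_reflection \<alpha> y"
  by (simp add: root_reflection_def inner_coroot algebra_simps inner_commute)

lemma root_reflection_involution [simp]:
  "root_reflection \<alpha> (root_reflection \<alpha> x) = x"
  by (cases "\<alpha> = 0") (simp_all add: root_reflection_def inner_coroot algebra_simps)

lemma root_reflection_self: "\<alpha> \<noteq> 0 \<Longrightarrow> root_reflection \<alpha> \<alpha> = - \<alpha>"
  by (simp add: root_reflection_def inner_coroot scaleR_2)

lemma root_reflection_minus [simp]: "root_reflection (- \<alpha>) = root_reflection \<alpha>"
  by (simp add: root_reflection_def inner_coroot fun_eq_iff)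

lemma coroot_minus [simp]: "coroot (- \<alpha>) = - coroot \<alpha>"
  by (simp add: coroot_def)

lemma coroot_root_reflection:
  "coroot (root_reflection \<alpha> \<gamma>) = root_reflection \<alpha> (coroot \<gamma>)"
proof -
  have "root_reflection \<alpha> \<gamma> \<bullet> root_reflection \<alpha> \<gamma> = \<gamma> \<bullet> \<gamma>"
    by (simp add: root_reflection_inner)
  then show ?thesis
    by (simp add: coroot_def linear_scale[OF linear_root_reflection])
qed

lemma Ints_le_add_one: "(a::real) \<in> \<int> \<Longrightarrow> b \<in> \<int> \<Longrightarrow> a < b \<Longrightarrow> a + 1 \<le> b"
  by (elim Ints_cases) simp

locale reduced_root_system =
  fixes \<Delta> :: "'a::euclidean_space set"
  assumes root_system: "root_system \<Delta>" and reduced: "reduced_roots \<Delta>"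
begin

lemma finite_roots: "finite \<Delta>"
  and root_nonzero: "\<alpha> \<in> \<Delta> \<Longrightarrow> \<alpha> \<noteq> 0"
  and reflection_root: "\<alpha> \<in> \<Delta> \<Longrightarrow> \<beta> \<in> \<Delta> \<Longrightarrow> root_reflection \<alpha> \<beta> \<in> \<Delta>"
  and coroot_int: "\<alpha> \<in> \<Delta> \<Longrightarrow> \<beta> \<in> \<Delta> \<Longrightarrow> \<beta> \<bullet> coroot \<alpha> \<in> \<int>"
  using root_system unfolding root_system_def by blast+

lemma minus_root: "\<alpha> \<in> \<Delta> \<Longrightarrow> - \<alpha> \<in> \<Delta>"
  using reflection_root[of \<alpha> \<alpha>] root_reflection_self root_nonzero by metis

lemma root_multiple: "\<alpha> \<in> \<Delta> \<Longrightarrow> c *\<^sub>R \<alpha> \<in> \<Delta> \<Longrightarrow> c = 1 \<or> c = - 1"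
  using reduced unfolding reduced_roots_def by blast

text \<open>The product of the two pairings is four times a squared cosine. Reducedness excludes
  parallel roots, so this product is below 4; being positive integers, the pairings cannot both be
  at least 2. Whichever equals 1 makes the corresponding reflection a plain subtraction.\<close>

lemma diff_root:
  assumes "\<alpha> \<in> \<Delta>" "\<beta> \<in> \<Delta>" "\<alpha> \<bullet> \<beta> > 0" "\<alpha> \<noteq> \<beta>"
  shows "\<alpha> - \<beta> \<in> \<Delta>"
proof -
  have nz: "\<alpha> \<bullet> \<alpha> > 0" "\<beta> \<bullet> \<beta> > 0"
    using assms root_nonzero by auto
  define a b where "a = \<alpha> \<bullet> coroot \<beta>" and "b = \<beta> \<bullet> coroot \<alpha>"
  have pos: "a > 0" "b > 0"
    using assms(3) nz by (auto simp: a_def b_def inner_coroot inner_commute)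
  have ab: "a * b = 4 * ((\<alpha> \<bullet> \<beta>)\<^sup>2 / ((\<alpha> \<bullet> \<alpha>) * (\<beta> \<bullet> \<beta>)))"
    by (simp add: a_def b_def inner_coroot power2_eq_square inner_commute)
  have "(\<alpha> \<bullet> \<beta>)\<^sup>2 \<noteq> (\<alpha> \<bullet> \<alpha>) * (\<beta> \<bullet> \<beta>)"
  proof
    assume eq: "(\<alpha> \<bullet> \<beta>)\<^sup>2 = (\<alpha> \<bullet> \<alpha>) * (\<beta> \<bullet> \<beta>)"
    \<comment> \<open>This is the coefficient of the orthogonal projection of \<alpha> onto \<beta>;
      equality in Cauchy-Schwarz means that the residual vanishes.\<close>
    define c where "c = (\<alpha> \<bullet> \<beta>) / (\<beta> \<bullet> \<beta>)"
    have "(\<alpha> - c *\<^sub>R \<beta>) \<bullet> (\<alpha> - c *\<^sub>R \<beta>) = \<alpha> \<bullet> \<alpha> - (\<alpha> \<bullet> \<beta>)\<^sup>2 / (\<beta> \<bullet> \<beta>)"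
      using nz unfolding c_def
      by (simp add: inner_diff_left inner_diff_right inner_commute power2_eq_square field_simps)
    also have "\<dots> = 0"
      using eq nz by simp
    finally have "\<alpha> = c *\<^sub>R \<beta>" by simp
    moreover have "c > 0" using assms(3) nz by (simp add: c_def)
    ultimately show False
      using root_multiple[of \<beta> c] assms by auto
  qed
  moreover have "(\<alpha> \<bullet> \<beta>)\<^sup>2 \<le> (\<alpha> \<bullet> \<alpha>) * (\<beta> \<bullet> \<beta>)"
    by (rule Cauchy_Schwarz_ineq)
  ultimately have "a * b < 4"
    unfolding ab using nz by (simp add: field_simps)
  obtain k l :: int where kl: "a = k" "b = l"
    using coroot_int assms unfolding a_def b_def by (metis Ints_cases)
  have "k * l < 4" "k > 0" "l > 0"
    using \<open>a * b < 4\<close> pos unfolding kl by (simp_all flip: of_int_mult)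
  have "k = 1 \<or> l = 1"
  proof (rule ccontr)
    assume "\<not> ?thesis"
    then have "2 * 2 \<le> k * l"
      using \<open>k > 0\<close> \<open>l > 0\<close> by (intro mult_mono) auto
    then show False using \<open>k * l < 4\<close> by simp
  qed
  then show ?thesis
  proof
    assume "k = 1"
    then show ?thesis
      using reflection_root[of \<beta> \<alpha>] assms kl by (simp add: root_reflection_def a_def)
  next
    assume "l = 1"
    then have "\<beta> - \<alpha> \<in> \<Delta>"
      using reflection_root[of \<alpha> \<beta>] assms kl by (simp add: root_reflection_def b_def)
    then show ?thesis using minus_root by fastforce
  qed
qed

section \<open>Simple roots\<close>

text \<open>Chambers are represented by regular points \<open>p\<close> in their interior.\<close>

definition regular :: "'a \<Rightarrow> bool" where
  "regular p \<longleftrightarrow> (\<forall>\<alpha>\<in>\<Delta>. \<alpha> \<bullet> p \<noteq> 0)"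

definition pos :: "'a \<Rightarrow> 'a set" where
  "pos p = {\<alpha>\<in>\<Delta>. \<alpha> \<bullet> p > 0}"

definition simple :: "'a \<Rightarrow> 'a set" where
  "simple p = {\<alpha>\<in>pos p. \<not> (\<exists>\<beta>\<in>pos p. \<exists>\<gamma>\<in>pos p. \<alpha> = \<beta> + \<gamma>)}"

text \<open>In the notation of the overview, \<open>x\<close> lies below \<open>y\<close> exactly
  when \<open>y - x\<close> is in \<open>qplus\<close>. Simple roots as generators give the same
  monoid as all positive roots, by \<open>pos_qplus\<close>, and make the coefficients
  unique.\<close>

definition qplus :: "'a \<Rightarrow> 'a set" where
  "qplus p = {x. \<exists>c::'a \<Rightarrow> nat. x = (\<Sum>\<alpha>\<in>simple p. real (c \<alpha>) *\<^sub>R \<alpha>)}"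

lemma finite_pos: "finite (pos p)"
  using finite_roots by (simp add: pos_def)

lemma simple_pos: "\<alpha> \<in> simple p \<Longrightarrow> \<alpha> \<in> pos p"
  by (simp add: simple_def)

lemma pos_root: "\<alpha> \<in> pos p \<Longrightarrow> \<alpha> \<in> \<Delta>"
  by (simp add: pos_def)

lemma simple_root: "\<alpha> \<in> simple p \<Longrightarrow> \<alpha> \<in> \<Delta>"
  by (simp add: simple_def pos_def)

lemma finite_simple: "finite (simple p)"
  using finite_pos by (simp add: simple_def)

lemma pos_cases: "regular p \<Longrightarrow> \<alpha> \<in> \<Delta> \<Longrightarrow> \<alpha> \<in> pos p \<or> - \<alpha> \<in> pos p"
  using minus_root by (force simp: regular_def pos_def)

text \<open>An acute pair would have a root as its difference. That root or its negative is
  positive, so one of the two simple roots would split as the other plus a positive root.\<close>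

lemma simple_obtuse:
  assumes "regular p" "\<alpha> \<in> simple p" "\<beta> \<in> simple p" "\<alpha> \<noteq> \<beta>"
  shows "\<alpha> \<bullet> \<beta> \<le> 0"
proof (rule ccontr)
  assume "\<not> ?thesis"
  then have "\<alpha> - \<beta> \<in> \<Delta>"
    using diff_root assms simple_root by auto
  then consider "\<alpha> - \<beta> \<in> pos p" | "\<beta> - \<alpha> \<in> pos p"
    using pos_cases assms by fastforce
  then show False
  proof cases
    case 1
    moreover have "\<alpha> = \<beta> + (\<alpha> - \<beta>)" by simp
    ultimately show False using assms simple_pos unfolding simple_def by blast
  next
    case 2
    moreover have "\<beta> = \<alpha> + (\<beta> - \<alpha>)" by simp
    ultimately show False using assms simple_pos unfolding simple_def by blast
  qed
qed

lemma simple_obtuse_coroot: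
  assumes "regular p" "\<alpha> \<in> simple p" "\<beta> \<in> simple p" "\<alpha> \<noteq> \<beta>"
  shows "\<alpha> \<bullet> coroot \<beta> \<le> 0"
  using simple_obtuse[OF assms] by (simp add: inner_coroot divide_nonpos_nonneg)

section \<open>Integral and real combinations of simple roots\<close>

lemma qplusI: "x = (\<Sum>\<alpha>\<in>simple p. real (c \<alpha>) *\<^sub>R \<alpha>) \<Longrightarrow> x \<in> qplus p"
  unfolding qplus_def by (intro CollectI exI)

lemma qplus_0: "0 \<in> qplus p"
  by (rule qplusI[where c = "\<lambda>_. 0"]) simp

lemma qplus_add:
  assumes "x \<in> qplus p" "y \<in> qplus p"
  shows "x + y \<in> qplus p"
proof -
  obtain c d :: "'a \<Rightarrow> nat" where
    "x = (\<Sum>\<alpha>\<in>simple p. real (c \<alpha>) *\<^sub>R \<alpha>)" "y = (\<Sum>\<alpha>\<in>simple p. real (d \<alpha>) *\<^sub>R \<alpha>)"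
    using assms unfolding qplus_def by blast
  then have "x + y = (\<Sum>\<alpha>\<in>simple p. real (c \<alpha> + d \<alpha>) *\<^sub>R \<alpha>)"
    by (simp add: sum.distrib algebra_simps)
  then show ?thesis by (rule qplusI)
qed

lemma qplus_sum: "(\<And>i. i \<in> A \<Longrightarrow> f i \<in> qplus p) \<Longrightarrow> sum f A \<in> qplus p"
  by (induction A rule: infinite_finite_induct) (auto simp: qplus_0 qplus_add)

lemma qplus_scale:
  assumes "x \<in> qplus p"
  shows "real n *\<^sub>R x \<in> qplus p"
  by (induction n) (auto simp: qplus_0 qplus_add assms algebra_simps)

lemma simple_qplus:
  assumes "\<alpha> \<in> simple p"
  shows "\<alpha> \<in> qplus p"
proof -
  have "\<alpha> = (\<Sum>\<beta>\<in>simple p. real (if \<beta> = \<alpha> then 1 else 0) *\<^sub>R \<beta>)"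
    using assms finite_simple by (simp add: if_distrib[of real] if_distrib[of "\<lambda>r. r *\<^sub>R _"] cong: if_cong)
  then show ?thesis by (rule qplusI)
qed

text \<open>A positive root that is not simple splits into two positive roots, each with a smaller
  value at \<open>p\<close>. The number of positive roots of smaller value is a well-founded measure
  for the induction.\<close>

lemma pos_qplus: "\<alpha> \<in> pos p \<Longrightarrow> \<alpha> \<in> qplus p"
proof (induction "card {\<beta>\<in>pos p. \<beta> \<bullet> p < \<alpha> \<bullet> p}" arbitrary: \<alpha> rule: less_induct)
  case less
  show ?case
  proof (cases "\<alpha> \<in> simple p")
    case False
    then obtain \<beta> \<gamma> where bg: "\<beta> \<in> pos p" "\<gamma> \<in> pos p" "\<alpha> = \<beta> + \<gamma>"
      using less.prems unfolding simple_def by blast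
    then have lt: "\<beta> \<bullet> p < \<alpha> \<bullet> p" "\<gamma> \<bullet> p < \<alpha> \<bullet> p"
      by (auto simp: pos_def inner_add_left)
    have "\<delta> \<in> qplus p" if "\<delta> \<in> pos p" "\<delta> \<bullet> p < \<alpha> \<bullet> p" for \<delta>
      using that finite_pos[of p]
      by (intro less.hyps psubset_card_mono psubsetI) (auto simp: set_eq_iff)
    then show ?thesis
      using bg lt qplus_add by blast
  qed (rule simple_qplus)
qed

text \<open>Moving the negative coefficients to the other side writes one vector \<open>v\<close> as
  a positive combination over \<open>A\<close> and over \<open>B\<close>. Obtuseness between
  \<open>A\<close> and \<open>B\<close> gives \<open>v \<bullet> v \<le> 0\<close>, hence
  \<open>v = 0\<close>; but simple roots are strictly positive at \<open>p\<close>, so both index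
  sets are empty.\<close>

lemma simple_independent:
  assumes p: "regular p" and zero: "(\<Sum>\<alpha>\<in>simple p. c \<alpha> *\<^sub>R \<alpha>) = 0" and "\<alpha> \<in> simple p"
  shows "c \<alpha> = 0"
proof -
  define A where "A = {\<alpha>\<in>simple p. c \<alpha> > 0}"
  define B where "B = {\<alpha>\<in>simple p. c \<alpha> < 0}"
  define v where "v = (\<Sum>\<alpha>\<in>A. c \<alpha> *\<^sub>R \<alpha>)"
  have fin: "finite A" "finite B"
    using finite_simple by (auto simp: A_def B_def)
  have "(\<Sum>\<alpha>\<in>simple p. c \<alpha> *\<^sub>R \<alpha>) = (\<Sum>\<alpha>\<in>A \<union> B. c \<alpha> *\<^sub>R \<alpha>)"
    using finite_simple by (intro sum.mono_neutral_right) (auto simp: A_def B_def)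
  also have "\<dots> = v + (\<Sum>\<alpha>\<in>B. c \<alpha> *\<^sub>R \<alpha>)"
    unfolding v_def using fin by (intro sum.union_disjoint) (auto simp: A_def B_def)
  finally have vB: "v = (\<Sum>\<alpha>\<in>B. (- c \<alpha>) *\<^sub>R \<alpha>)"
    using zero by (simp add: sum_negf eq_neg_iff_add_eq_0)
  have "v \<bullet> v = (\<Sum>\<alpha>\<in>A. c \<alpha> *\<^sub>R \<alpha>) \<bullet> (\<Sum>\<beta>\<in>B. (- c \<beta>) *\<^sub>R \<beta>)"
    using vB v_def by simp
  also have "\<dots> = (\<Sum>\<alpha>\<in>A. \<Sum>\<beta>\<in>B. c \<alpha> * ((- c \<beta>) * (\<alpha> \<bullet> \<beta>)))"
    unfolding inner_sum_left unfolding inner_sum_right by (simp add: mult.left_commute)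
  also have "\<dots> \<le> 0"
    using simple_obtuse[OF p]
    by (intro sum_nonpos mult_nonneg_nonpos) (fastforce simp: A_def B_def)+
  finally have "v \<bullet> v = 0" using inner_ge_zero[of v] by linarith
  then have "v = 0" by simp
  have "(\<Sum>\<alpha>\<in>A. c \<alpha> * (\<alpha> \<bullet> p)) = 0"
    using arg_cong[OF \<open>v = 0\<close>, of "\<lambda>x. x \<bullet> p"] unfolding v_def by (simp add: inner_sum_left)
  moreover have "c \<alpha> * (\<alpha> \<bullet> p) > 0" if "\<alpha> \<in> A" for \<alpha>
    using that simple_pos[of \<alpha> p] by (auto simp: A_def pos_def)
  ultimately have "A = {}"
    using fin sum_pos[of A "\<lambda>\<alpha>. c \<alpha> * (\<alpha> \<bullet> p)"] by force
  have "(\<Sum>\<alpha>\<in>B. (- c \<alpha>) * (\<alpha> \<bullet> p)) = 0"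
    using arg_cong[OF \<open>v = 0\<close>, of "\<lambda>x. x \<bullet> p"] unfolding vB by (simp add: inner_sum_left)
  moreover have "(- c \<alpha>) * (\<alpha> \<bullet> p) > 0" if "\<alpha> \<in> B" for \<alpha>
    using that simple_pos[of \<alpha> p] by (auto simp: B_def pos_def intro: mult_neg_pos)
  ultimately have "B = {}"
    using fin sum_pos[of B "\<lambda>\<alpha>. (- c \<alpha>) * (\<alpha> \<bullet> p)"] by force
  with \<open>A = {}\<close> show ?thesis
    using assms(3) by (metis (mono_tags, lifting) A_def B_def empty_iff linorder_neqE_linordered_idom mem_Collect_eq)
qed

lemma simple_coefficients_unique:
  assumes "regular p" "(\<Sum>\<alpha>\<in>simple p. c \<alpha> *\<^sub>R \<alpha>) = (\<Sum>\<alpha>\<in>simple p. d \<alpha> *\<^sub>R \<alpha>)" "\<alpha> \<in> simple p"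
  shows "c \<alpha> = d \<alpha>"
  using simple_independent[of p "\<lambda>\<alpha>. c \<alpha> - d \<alpha>" \<alpha>] assms
  by (simp add: scaleR_diff_left sum_subtractf)

text \<open>The reflection alters \<alpha> only by a multiple of \<delta>. If the image were
  negative, adding the expansions of \<alpha> and of minus its image would give a multiple of
  \<delta>. All other coefficients, being nonnegative, would then vanish, and reducedness would
  force \<alpha> to be \<delta>.\<close>

lemma reflection_pos:
  assumes p: "regular p" and d: "\<delta> \<in> simple p" and a: "\<alpha> \<in> pos p" "\<alpha> \<noteq> \<delta>"
  shows "root_reflection \<delta> \<alpha> \<in> pos p"
proof (rule ccontr)
  assume "\<not> ?thesis"
  then have neg: "- root_reflection \<delta> \<alpha> \<in> pos p"
    using pos_cases[OF p] reflection_root simple_root pos_root d a by blast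
  obtain n k :: "'a \<Rightarrow> nat" where
    n: "\<alpha> = (\<Sum>\<beta>\<in>simple p. real (n \<beta>) *\<^sub>R \<beta>)" and
    k: "- root_reflection \<delta> \<alpha> = (\<Sum>\<beta>\<in>simple p. real (k \<beta>) *\<^sub>R \<beta>)"
    using pos_qplus[OF a(1)] pos_qplus[OF neg] unfolding qplus_def by blast
  have "(\<Sum>\<beta>\<in>simple p. (real (n \<beta>) + real (k \<beta>)) *\<^sub>R \<beta>) = (\<alpha> \<bullet> coroot \<delta>) *\<^sub>R \<delta>"
    unfolding scaleR_add_left sum.distrib n[symmetric] k[symmetric]
    by (simp add: root_reflection_def)
  also have "\<dots> = (\<Sum>\<beta>\<in>simple p. (if \<beta> = \<delta> then \<alpha> \<bullet> coroot \<delta> else 0) *\<^sub>R \<beta>)"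
    using d finite_simple by (simp add: if_distrib[of "\<lambda>r. r *\<^sub>R _"] cong: if_cong)
  finally have eq: "real (n \<beta>) + real (k \<beta>) = (if \<beta> = \<delta> then \<alpha> \<bullet> coroot \<delta> else 0)" if "\<beta> \<in> simple p" for \<beta>
    by (rule simple_coefficients_unique[OF p _ that])
  have "n \<beta> = 0" if "\<beta> \<in> simple p" "\<beta> \<noteq> \<delta>" for \<beta>
    using eq[OF that(1)] that(2) by simp
  then have "\<alpha> = real (n \<delta>) *\<^sub>R \<delta>"
    using d finite_simple unfolding n
    by (subst sum.remove[of _ \<delta>]) auto
  then have "real (n \<delta>) = 1"
    using root_multiple[of \<delta> "real (n \<delta>)"] a(1) d simple_root pos_root by force
  then show False using \<open>\<alpha> = real (n \<delta>) *\<^sub>R \<delta>\<close> a(2) by simp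
qed

section \<open>Positive systems under a simple reflection\<close>

lemma regular_reflection:
  assumes "regular p" "\<delta> \<in> \<Delta>"
  shows "regular (root_reflection \<delta> p)"
  using assms reflection_root unfolding regular_def by (metis root_reflection_inner)

lemma pos_reflection_iff:
  assumes "\<delta> \<in> \<Delta>"
  shows "\<alpha> \<in> pos (root_reflection \<delta> p) \<longleftrightarrow> root_reflection \<delta> \<alpha> \<in> pos p"
  using assms reflection_root[OF assms, of \<alpha>] reflection_root[OF assms, of "root_reflection \<delta> \<alpha>"]
  by (auto simp: pos_def root_reflection_inner)

text \<open>Crossing the wall of \<delta> flips a single sign. Both the description of common walls
  and the decreasing measure in \<open>gallery_induct\<close> rest on this.\<close>

lemma pos_reflection:
  assumes p: "regular p" and d: "\<delta> \<in> simple p"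
  shows "pos (root_reflection \<delta> p) = insert (- \<delta>) (pos p - {\<delta>})"
proof -
  have nz: "\<delta> \<noteq> 0" and D: "\<delta> \<in> \<Delta>" using root_nonzero simple_root d by auto
  have self: "root_reflection \<delta> (- \<delta>) = \<delta>"
    using root_reflection_involution[of \<delta> \<delta>] root_reflection_self[OF nz] by simp
  have neg: "- \<delta> \<notin> pos p" using simple_pos[OF d] by (simp add: pos_def)
  show ?thesis
  proof (intro set_eqI)
    fix \<alpha>
    show "\<alpha> \<in> pos (root_reflection \<delta> p) \<longleftrightarrow> \<alpha> \<in> insert (- \<delta>) (pos p - {\<delta>})"
    proof (cases "\<alpha> = - \<delta> \<or> \<alpha> = \<delta>")
      case True
      then show ?thesis
        using self neg simple_pos[OF d] root_reflection_self[OF nz]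
        by (auto simp: pos_reflection_iff[OF D])
    next
      case False
      then have "root_reflection \<delta> \<alpha> \<noteq> \<delta>"
        by (metis root_reflection_involution root_reflection_self nz)
      then show ?thesis
        using False reflection_pos[OF p d, of \<alpha>] reflection_pos[OF p d, of "root_reflection \<delta> \<alpha>"]
        by (auto simp: pos_reflection_iff[OF D])
    qed
  qed
qed

lemma minus_simple_reflection:
  assumes d: "\<delta> \<in> simple p"
  shows "- \<delta> \<in> simple (root_reflection \<delta> p)"
proof -
  have nz: "\<delta> \<noteq> 0" and D: "\<delta> \<in> \<Delta>" using root_nonzero simple_root d by auto
  have self: "root_reflection \<delta> (- \<delta>) = \<delta>"
    using root_reflection_involution[of \<delta> \<delta>] root_reflection_self[OF nz] by simp
  show ?thesis
    unfolding simple_def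
  proof (safe)
    show "- \<delta> \<in> pos (root_reflection \<delta> p)"
      using self simple_pos[OF d] by (simp add: pos_reflection_iff[OF D])
    fix \<beta> \<gamma> assume "\<beta> \<in> pos (root_reflection \<delta> p)" "\<gamma> \<in> pos (root_reflection \<delta> p)" "- \<delta> = \<beta> + \<gamma>"
    then show False
      using d self linear_add[OF linear_root_reflection, of \<delta> \<beta> \<gamma>]
      unfolding pos_reflection_iff[OF D] simple_def by (metis (mono_tags, lifting) mem_Collect_eq)
  qed
qed

section \<open>Chambers and galleries\<close>

definition chamber :: "'a \<Rightarrow> 'a set" where
  "chamber p = {y. \<forall>\<alpha>\<in>pos p. \<alpha> \<bullet> y \<ge> 0}"

definition open_chamber :: "'a \<Rightarrow> 'a set" where
  "open_chamber p = {y. \<forall>\<alpha>\<in>pos p. \<alpha> \<bullet> y > 0}"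

lemma mem_open_chamber: "p \<in> open_chamber p"
  by (simp add: open_chamber_def pos_def)

lemma open_open_chamber: "open (open_chamber p)"
proof -
  have "open_chamber p = (\<Inter>\<alpha>\<in>pos p. {y. \<alpha> \<bullet> y > 0})"
    by (auto simp: open_chamber_def)
  then show ?thesis
    using finite_pos by (auto intro: open_INT open_halfspace_gt)
qed

lemma convex_open_chamber: "convex (open_chamber p)"
proof -
  have "open_chamber p = (\<Inter>\<alpha>\<in>pos p. {y. \<alpha> \<bullet> y > 0})"
    by (auto simp: open_chamber_def)
  then show ?thesis
    by (auto intro: convex_INT convex_halfspace_gt)
qed

lemma convex_chamber: "convex (chamber p)"
proof -
  have "chamber p = (\<Inter>\<alpha>\<in>pos p. {y. \<alpha> \<bullet> y \<ge> 0})"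
    by (auto simp: chamber_def)
  then show ?thesis
    by (auto intro: convex_INT convex_halfspace_ge)
qed

lemma closure_open_chamber: "closure (open_chamber p) = chamber p"
proof
  have "chamber p = (\<Inter>\<alpha>\<in>pos p. {y. \<alpha> \<bullet> y \<ge> 0})"
    by (auto simp: chamber_def)
  then have "closed (chamber p)"
    by (auto intro: closed_INT closed_halfspace_ge)
  then show "closure (open_chamber p) \<subseteq> chamber p"
    by (intro closure_minimal) (auto simp: open_chamber_def chamber_def order_less_imp_le)
  show "chamber p \<subseteq> closure (open_chamber p)"
  proof
    fix y assume y: "y \<in> chamber p"
    \<comment> \<open>A point of the closed cone is approached by pushing it slightly in the
      direction of \<open>p\<close>, where all positive roots are strictly positive.\<close>
    have "(\<lambda>n. y + inverse (real (Suc n)) *\<^sub>R p) \<longlonglongrightarrow> y + 0 *\<^sub>R p"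
      by (intro tendsto_intros LIMSEQ_inverse_real_of_nat)
    moreover have "y + inverse (real (Suc n)) *\<^sub>R p \<in> open_chamber p" for n
      using y by (auto simp: open_chamber_def chamber_def inner_add_right pos_def
          intro!: add_nonneg_pos)
    ultimately show "y \<in> closure (open_chamber p)"
      unfolding closure_sequential
      by (intro exI[of _ "\<lambda>n. y + inverse (real (Suc n)) *\<^sub>R p"]) simp
  qed
qed

lemma interior_chamber: "interior (chamber p) = open_chamber p"
  using convex_interior_closure[OF convex_open_chamber] open_open_chamber closure_open_chamber
  by (metis interior_open)

text \<open>A connected set that contains \<open>p\<close> and avoids the root hyperplanes cannot
  change the sign of any root, by the intermediate value theorem; hence it cannot leave the open
  chamber.\<close>

lemma open_chamber_component:
  assumes p: "regular p"
  shows "open_chamber p \<in> components (UNIV - (\<Union>\<alpha>\<in>\<Delta>. {y. \<alpha> \<bullet> y = 0}))"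
  unfolding in_components_maximal
proof (intro conjI allI impI)
  show "open_chamber p \<noteq> {}" using mem_open_chamber by blast
  show "connected (open_chamber p)" using convex_open_chamber convex_connected by blast
  show "open_chamber p \<subseteq> UNIV - (\<Union>\<alpha>\<in>\<Delta>. {y. \<alpha> \<bullet> y = 0})"
    using pos_cases[OF p] by (force simp: open_chamber_def)
  fix D assume D: "D \<noteq> {} \<and> open_chamber p \<subseteq> D \<and> D \<subseteq> UNIV - (\<Union>\<alpha>\<in>\<Delta>. {y. \<alpha> \<bullet> y = 0}) \<and> connected D"
  have "\<alpha> \<bullet> y > 0" if "y \<in> D" "\<alpha> \<in> pos p" for y \<alpha>
  proof (rule ccontr)
    assume "\<not> ?thesis"
    moreover have "connected D" "p \<in> D" "\<alpha> \<bullet> p \<ge> 0"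
      using D that mem_open_chamber by (auto simp: pos_def)
    ultimately obtain x where "x \<in> D" "\<alpha> \<bullet> x = 0"
      using connected_ivt_hyperplane[of D y p \<alpha> 0] \<open>y \<in> D\<close> by auto
    then show False using D pos_root[OF that(2)] by blast
  qed
  then show "D = open_chamber p"
    using D by (auto simp: open_chamber_def)
qed

lemma chamber_in_chambers: "regular p \<Longrightarrow> chamber p \<in> chambers \<Delta>"
  unfolding chambers_def using open_chamber_component closure_open_chamber by blast

lemma chambers_cases:
  assumes "\<sigma> \<in> chambers \<Delta>"
  obtains p where "regular p" "\<sigma> = chamber p"
proof -
  define A where "A = UNIV - (\<Union>\<alpha>\<in>\<Delta>. {y. \<alpha> \<bullet> y = 0})"
  obtain C where C: "C \<in> components A" "\<sigma> = closure C"
    using assms unfolding chambers_def A_def by blast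
  obtain p where "p \<in> C" using C(1) in_components_nonempty by blast
  then have "p \<in> A" using C(1) in_components_subset by blast
  then have p: "regular p" by (auto simp: A_def regular_def)
  then have "C = open_chamber p"
    using components_eq[OF C(1), of "open_chamber p"] open_chamber_component[OF p] \<open>p \<in> C\<close> mem_open_chamber
    unfolding A_def by blast
  then show thesis
    using that p C(2) closure_open_chamber by simp
qed

lemma positive_on_chamber:
  assumes p: "regular p" and a: "\<alpha> \<in> \<Delta>"
  shows "positive_on (chamber p) \<alpha> \<longleftrightarrow> \<alpha> \<in> pos p"
  using mem_open_chamber[of p] a
  by (auto simp: positive_on_def interior_chamber) (auto simp: open_chamber_def pos_def)

lemma negative_on_chamber:
  assumes p: "regular p" and a: "\<alpha> \<in> \<Delta>"
  shows "negative_on (chamber p) \<alpha> \<longleftrightarrow> - \<alpha> \<in> pos p"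
  using positive_on_chamber[OF p minus_root[OF a]]
  by (simp add: positive_on_def negative_on_def)

lemma simple_roots_chamber:
  assumes p: "regular p"
  shows "simple_roots \<Delta> (chamber p) = simple p"
proof -
  have "positive_roots \<Delta> (chamber p) = pos p"
    using positive_on_chamber[OF p] pos_root by (auto simp: positive_roots_def)
  then show ?thesis by (simp add: simple_roots_def simple_def)
qed

text \<open>On its own hyperplane the constraint of \<delta> is automatic. The remaining constraints
  come from \<open>pos p - {\<delta>}\<close>, which is common to both sides of the wall, so both
  chambers have the same wall.\<close>

lemma wall_eq:
  assumes p: "regular p" and d: "\<delta> \<in> simple p"
  shows "chamber p \<inter> {y. \<delta> \<bullet> y = 0} = {y. \<delta> \<bullet> y = 0 \<and> (\<forall>\<alpha>\<in>pos p - {\<delta>}. \<alpha> \<bullet> y \<ge> 0)}"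
proof (intro set_eqI)
  fix y
  show "y \<in> chamber p \<inter> {y. \<delta> \<bullet> y = 0} \<longleftrightarrow>
      y \<in> {y. \<delta> \<bullet> y = 0 \<and> (\<forall>\<alpha>\<in>pos p - {\<delta>}. \<alpha> \<bullet> y \<ge> 0)}"
    unfolding chamber_def by (cases "\<delta> \<bullet> y = 0") force+
qed

text \<open>All positive roots other than \<delta> are strictly positive at a suitable point
  \<open>q\<close> of the hyperplane. The wall therefore contains a nonempty relatively open part of
  the hyperplane and has codimension one.\<close>

lemma wall_facet:
  assumes p: "regular p" and d: "\<delta> \<in> simple p"
  shows "(chamber p \<inter> {y. \<delta> \<bullet> y = 0}) facet_of chamber p"
proof -
  define H where "H = {y. \<delta> \<bullet> y = 0}"
  define U where "U = (\<Inter>\<alpha>\<in>pos p - {\<delta>}. {y. \<alpha> \<bullet> y > 0})"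
  \<comment> \<open>The orthogonal projection of \<open>p\<close> onto the hyperplane is the
    midpoint of \<open>p\<close> and its mirror image. The value of \<alpha> there is the mean of
    the values at \<open>p\<close> of \<alpha> and of its reflection, both positive by
    \<open>reflection_pos\<close>.\<close>
  define q where "q = p - ((p \<bullet> \<delta>) / (\<delta> \<bullet> \<delta>)) *\<^sub>R \<delta>"
  have nz: "\<delta> \<noteq> 0" using d simple_root root_nonzero by blast
  have openU: "open U"
    using finite_pos unfolding U_def by (auto intro: open_INT open_halfspace_gt)
  have q2: "2 *\<^sub>R q = p + root_reflection \<delta> p"
    by (simp add: q_def root_reflection_def inner_coroot scaleR_diff_right scaleR_2[of p])
  have qH: "q \<in> H" using nz by (simp add: q_def H_def inner_diff_right inner_commute)
  have qU: "q \<in> U"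
    unfolding U_def
  proof (safe)
    fix \<alpha> assume a: "\<alpha> \<in> pos p" "\<alpha> \<noteq> \<delta>"
    have "2 * (\<alpha> \<bullet> q) = \<alpha> \<bullet> p + root_reflection \<delta> \<alpha> \<bullet> p"
      unfolding root_reflection_inner inner_add_right[symmetric] q2[symmetric] by simp
    then show "\<alpha> \<bullet> q > 0" using a reflection_pos[OF p d a] by (simp add: pos_def)
  qed
  have "aff_dim (H \<inter> U) = aff_dim H"
  proof (rule aff_dim_convex_Int_open[OF _ openU])
    show "convex H" unfolding H_def by (rule convex_hyperplane)
    show "H \<inter> U \<noteq> {}" using qH qU by blast
  qed
  moreover have "H \<inter> U \<subseteq> chamber p \<inter> H"
    unfolding H_def wall_eq[OF p d] by (force simp: U_def intro: less_imp_le)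
  ultimately have dim: "aff_dim (chamber p \<inter> H) = aff_dim H"
    by (metis aff_dim_subset inf_le2 order_antisym)
  have "aff_dim (chamber p) = DIM('a)"
    using mem_open_chamber[of p] interior_chamber[of p] by (intro aff_dim_nonempty_interior) auto
  moreover have "(chamber p \<inter> H) face_of chamber p"
    unfolding H_def
    using simple_pos[OF d]
    by (intro face_of_Int_supporting_hyperplane_ge convex_chamber) (auto simp: chamber_def)
  moreover have "chamber p \<inter> H \<noteq> {}"
    using qH qU \<open>H \<inter> U \<subseteq> chamber p \<inter> H\<close> by blast
  ultimately show ?thesis
    using dim nz unfolding facet_of_def H_def by simp
qed

text \<open>This makes the edge condition of an ample polytope applicable to each step of a
  gallery.\<close>

lemma adjacent_reflection:
  assumes p: "regular p" and d: "\<delta> \<in> simple p"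
  shows "adjacent (chamber p) (chamber (root_reflection \<delta> p))"
    and "wall_root \<Delta> (chamber p) (chamber (root_reflection \<delta> p)) = \<delta>"
proof -
  let ?q = "root_reflection \<delta> p"
  have D: "\<delta> \<in> \<Delta>" and q: "regular ?q" and dq: "- \<delta> \<in> simple ?q"
    using simple_root[OF d] regular_reflection[OF p] minus_simple_reflection[OF d] by auto
  have posq: "pos ?q = insert (- \<delta>) (pos p - {\<delta>})" by (rule pos_reflection[OF p d])
  have ndp: "- \<delta> \<notin> pos p" using simple_pos[OF d] by (simp add: pos_def)
  have "chamber ?q \<inter> {y. (- \<delta>) \<bullet> y = 0} = chamber p \<inter> {y. \<delta> \<bullet> y = 0}"
    unfolding wall_eq[OF p d] wall_eq[OF q dq] posq using ndp by auto
  then have "(chamber p \<inter> {y. \<delta> \<bullet> y = 0}) facet_of chamber ?q"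
    using wall_facet[OF q dq] by simp
  moreover have "chamber p \<noteq> chamber ?q"
  proof
    assume "chamber p = chamber ?q"
    then have "- \<delta> \<in> pos p"
      using positive_on_chamber[OF p minus_root[OF D]] positive_on_chamber[OF q minus_root[OF D]] posq by simp
    then show False using ndp by simp
  qed
  ultimately show "adjacent (chamber p) (chamber ?q)"
    unfolding adjacent_def using wall_facet[OF p d] by blast
  show "wall_root \<Delta> (chamber p) (chamber ?q) = \<delta>"
    unfolding wall_root_def
  proof (rule the_equality)
    show "\<delta> \<in> \<Delta> \<and> positive_on (chamber p) \<delta> \<and> negative_on (chamber ?q) \<delta>"
      using D positive_on_chamber[OF p D] negative_on_chamber[OF q D] posq simple_pos[OF d] by simp
    fix \<alpha> assume a: "\<alpha> \<in> \<Delta> \<and> positive_on (chamber p) \<alpha> \<and> negative_on (chamber ?q) \<alpha>"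
    then have "\<alpha> \<in> pos p" "- \<alpha> \<in> insert (- \<delta>) (pos p - {\<delta>})"
      using positive_on_chamber[OF p] negative_on_chamber[OF q] posq by auto
    then show "\<alpha> = \<delta>" by (auto simp: pos_def)
  qed
qed

section \<open>Galleries and the choice of a chamber\<close>

lemma pos_eqI:
  assumes p: "regular p" and q: "regular q" and "pos p \<subseteq> pos q"
  shows "pos p = pos q"
proof
  show "pos q \<subseteq> pos p"
  proof
    fix \<alpha> assume a: "\<alpha> \<in> pos q"
    then have "- \<alpha> \<notin> pos q" by (simp add: pos_def)
    then show "\<alpha> \<in> pos p" using pos_cases[OF p pos_root[OF a]] assms(3) by blast
  qed
qed fact

text \<open>Every chamber is reached from \<open>chamber p\<close> by a gallery crossing only walls on whose near
  side \<open>p\<close> lies.\<close>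

lemma gallery_induct [consumes 2, case_names base step]:
  assumes p: "regular p" and q: "regular q" and base: "Q (chamber p)"
    and step: "\<And>q \<delta>. regular q \<Longrightarrow> \<delta> \<in> simple q \<Longrightarrow> \<delta> \<in> pos p \<Longrightarrow> Q (chamber q)
      \<Longrightarrow> Q (chamber (root_reflection \<delta> q))"
  shows "Q (chamber q)"
  using q
proof (induction "card (pos p - pos q)" arbitrary: q rule: less_induct)
  case less
  show ?case
  proof (cases "simple q \<subseteq> pos p")
    \<comment> \<open>If every simple root of \<open>q\<close> is positive at \<open>p\<close>, so
      is every positive root of \<open>q\<close>; both points then have the same chamber.\<close>
    case True
    have "\<alpha> \<bullet> p \<ge> 0" if a: "\<alpha> \<in> pos q" for \<alpha>
    proof -
      obtain c :: "'a \<Rightarrow> nat" where "\<alpha> = (\<Sum>\<beta>\<in>simple q. real (c \<beta>) *\<^sub>R \<beta>)"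
        using pos_qplus[OF a] unfolding qplus_def by blast
      then show ?thesis
        using True by (auto simp: inner_sum_left pos_def intro!: sum_nonneg mult_nonneg_nonneg)
    qed
    moreover have "\<alpha> \<bullet> p \<noteq> 0" if "\<alpha> \<in> pos q" for \<alpha>
      using p pos_root[OF that] by (simp add: regular_def)
    ultimately have "pos q \<subseteq> pos p"
      by (force simp: pos_def less_le)
    then have "pos q = pos p" using pos_eqI less.prems p by blast
    then show ?thesis using base by (simp add: chamber_def)
  next
    case False
    then obtain \<delta> where d: "\<delta> \<in> simple q" "\<delta> \<notin> pos p" by blast
    let ?q = "root_reflection \<delta> q"
    have q': "regular ?q" "- \<delta> \<in> simple ?q"
      using regular_reflection[OF less.prems] minus_simple_reflection simple_root d by auto
    have dp: "- \<delta> \<in> pos p" using d pos_cases[OF p simple_root[OF d(1)]] by blast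
    have "- \<delta> \<notin> pos q" using simple_pos[OF d(1)] by (simp add: pos_def)
    then have "pos p - pos ?q \<subset> pos p - pos q"
      using dp d unfolding pos_reflection[OF less.prems d(1)] by blast
    then have "card (pos p - pos ?q) < card (pos p - pos q)"
      using finite_pos by (intro psubset_card_mono) auto
    \<comment> \<open>The neighbour across the wall of \<delta> is closer to \<open>p\<close>.
      Crossing back through \<open>- \<delta>\<close>, which is positive at \<open>p\<close>, is a
      permitted step and returns to \<open>q\<close>.\<close>
    then have "Q (chamber ?q)" using less.hyps q'(1) by blast
    then have "Q (chamber (root_reflection (- \<delta>) ?q))"
      using step[OF q' dp] by blast
    then show ?thesis by simp
  qed
qed

text \<open>Roots positive at \<open>x\<close> stay positive on an open neighbourhood
  \<open>U\<close>. The finitely many root hyperplanes are negligible, so \<open>U\<close> contains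
  a regular point. The result is a chamber containing \<open>x\<close>, that is, one for which
  \<open>x\<close> is dominant.\<close>

lemma exists_regular_near:
  obtains p where "regular p" "\<And>\<alpha>. \<alpha> \<in> pos p \<Longrightarrow> \<alpha> \<bullet> x \<ge> 0"
proof -
  define U where "U = (\<Inter>\<alpha>\<in>{\<alpha>\<in>\<Delta>. \<alpha> \<bullet> x > 0}. {y. \<alpha> \<bullet> y > 0})"
  define N where "N = (\<Union>\<alpha>\<in>\<Delta>. {y. \<alpha> \<bullet> y = 0})"
  have "open U"
    unfolding U_def using finite_roots by (auto intro: open_INT open_halfspace_gt)
  moreover have "x \<in> U" by (simp add: U_def)
  ultimately have "\<not> negligible U" using open_not_negligible by blast
  moreover have "negligible N"
    unfolding N_def using finite_roots root_nonzero
    by (intro negligible_Union) (auto intro!: negligible_hyperplane)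
  ultimately obtain p where p: "p \<in> U" "p \<notin> N" using negligible_subset by blast
  have "\<alpha> \<bullet> x \<ge> 0" if a: "\<alpha> \<in> pos p" for \<alpha>
  proof (rule ccontr)
    assume "\<not> ?thesis"
    then have "- \<alpha> \<in> {\<alpha>\<in>\<Delta>. \<alpha> \<bullet> x > 0}"
      using minus_root pos_root[OF a] by simp
    then have "(- \<alpha>) \<bullet> p > 0" using p(1) unfolding U_def by blast
    then show False using a by (simp add: pos_def)
  qed
  then show thesis using that p(2) by (simp add: N_def regular_def)
qed

section \<open>The root lattice\<close>

lemma root_lattice_zero: "0 \<in> root_lattice \<Delta>"
  and root_lattice_root: "\<alpha> \<in> \<Delta> \<Longrightarrow> \<alpha> \<in> root_lattice \<Delta>"
  and root_lattice_add: "x \<in> root_lattice \<Delta> \<Longrightarrow> y \<in> root_lattice \<Delta> \<Longrightarrow> x + y \<in> root_lattice \<Delta>"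
  and root_lattice_scale: "x \<in> root_lattice \<Delta> \<Longrightarrow> of_int k *\<^sub>R x \<in> root_lattice \<Delta>"
  unfolding root_lattice_def int_span_def
  using module.span_zero[OF module_int_scaleR] module.span_base[OF module_int_scaleR]
    module.span_add[OF module_int_scaleR] module.span_scale[OF module_int_scaleR]
  by blast+

lemma root_lattice_diff:
  "x \<in> root_lattice \<Delta> \<Longrightarrow> y \<in> root_lattice \<Delta> \<Longrightarrow> x - y \<in> root_lattice \<Delta>"
  using root_lattice_add[of x "- y"] root_lattice_scale[of y "- 1"] by simp

lemma root_lattice_minimal:
  assumes "\<Delta> \<subseteq> T" "0 \<in> T" "\<And>x y. x \<in> T \<Longrightarrow> y \<in> T \<Longrightarrow> x + y \<in> T"
    "\<And>k x. x \<in> T \<Longrightarrow> of_int k *\<^sub>R x \<in> T"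
  shows "root_lattice \<Delta> \<subseteq> T"
  unfolding root_lattice_def int_span_def
  using assms by (intro module.span_minimal[OF module_int_scaleR])
    (auto simp: module.subspace_def[OF module_int_scaleR])

lemma qplus_root_lattice:
  assumes "x \<in> qplus p"
  shows "x \<in> root_lattice \<Delta>"
proof -
  obtain c :: "'a \<Rightarrow> nat" where x: "x = (\<Sum>\<alpha>\<in>simple p. real (c \<alpha>) *\<^sub>R \<alpha>)"
    using assms unfolding qplus_def by blast
  have "(\<Sum>\<alpha>\<in>A. real (c \<alpha>) *\<^sub>R \<alpha>) \<in> root_lattice \<Delta>" if "A \<subseteq> \<Delta>" for A
    using that
  proof (induction A rule: infinite_finite_induct)
    case (insert a A)
    then show ?case
      using root_lattice_add root_lattice_scale[OF root_lattice_root, of a "int (c a)"] by simp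
  qed (simp_all add: root_lattice_zero)
  then show ?thesis using x simple_root by blast
qed

lemma root_lattice_pairing_int:
  assumes "x \<in> root_lattice \<Delta>" "\<gamma> \<in> \<Delta>"
  shows "x \<bullet> coroot \<gamma> \<in> \<int>"
proof -
  have "root_lattice \<Delta> \<subseteq> {x. x \<bullet> coroot \<gamma> \<in> \<int>}"
    using assms(2) coroot_int by (intro root_lattice_minimal) (auto simp: inner_add_left)
  then show ?thesis using assms(1) by blast
qed

lemma weight_pairing_int:
  assumes "x \<in> weight_lattice \<Delta>" "\<gamma> \<in> \<Delta>"
  shows "x \<bullet> coroot \<gamma> \<in> \<int>"
proof -
  have "coroot \<gamma> \<in> coroot_lattice \<Delta>"
    unfolding coroot_lattice_def int_span_def
    using assms(2) by (intro module.span_base[OF module_int_scaleR]) simp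
  then show ?thesis using assms(1) unfolding weight_lattice_def by blast
qed

lemma root_lattice_simple_coefficients:
  assumes p: "regular p" and "x \<in> root_lattice \<Delta>"
  obtains c :: "'a \<Rightarrow> int" where "x = (\<Sum>\<alpha>\<in>simple p. of_int (c \<alpha>) *\<^sub>R \<alpha>)"
proof -
  define T where "T = {x. \<exists>c::'a \<Rightarrow> int. x = (\<Sum>\<alpha>\<in>simple p. of_int (c \<alpha>) *\<^sub>R \<alpha>)}"
  have TI: "x \<in> T" if "x = (\<Sum>\<alpha>\<in>simple p. of_int (c \<alpha>) *\<^sub>R \<alpha>)" for x c
    unfolding T_def using that by (intro CollectI exI)
  have scale: "of_int k *\<^sub>R x \<in> T" if "x \<in> T" for k x
  proof -
    obtain c :: "'a \<Rightarrow> int" where "x = (\<Sum>\<alpha>\<in>simple p. of_int (c \<alpha>) *\<^sub>R \<alpha>)"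
      using \<open>x \<in> T\<close> unfolding T_def by blast
    then show ?thesis by (intro TI[of _ "\<lambda>\<alpha>. k * c \<alpha>"]) (simp add: scaleR_sum_right)
  qed
  have pos: "pos p \<subseteq> T"
  proof
    fix \<alpha> assume "\<alpha> \<in> pos p"
    then obtain c :: "'a \<Rightarrow> nat" where "\<alpha> = (\<Sum>\<alpha>\<in>simple p. real (c \<alpha>) *\<^sub>R \<alpha>)"
      using pos_qplus unfolding qplus_def by blast
    then show "\<alpha> \<in> T" by (intro TI[of _ "\<lambda>\<alpha>. int (c \<alpha>)"]) simp
  qed
  have "root_lattice \<Delta> \<subseteq> T"
  proof (rule root_lattice_minimal)
    show "\<Delta> \<subseteq> T"
    proof
      fix \<alpha> assume "\<alpha> \<in> \<Delta>"
      then have "\<alpha> \<in> T \<or> - \<alpha> \<in> T" using pos_cases[OF p] pos by blast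
      then show "\<alpha> \<in> T" using scale[of "- \<alpha>" "- 1"] by auto
    qed
    show "0 \<in> T" by (rule TI[of _ "\<lambda>_. 0"]) simp
    fix x y assume "x \<in> T" "y \<in> T"
    then obtain c d :: "'a \<Rightarrow> int" where "x = (\<Sum>\<alpha>\<in>simple p. of_int (c \<alpha>) *\<^sub>R \<alpha>)"
      "y = (\<Sum>\<alpha>\<in>simple p. of_int (d \<alpha>) *\<^sub>R \<alpha>)"
      unfolding T_def by blast
    then show "x + y \<in> T"
      by (intro TI[of _ "\<lambda>\<alpha>. c \<alpha> + d \<alpha>"]) (simp add: scaleR_add_left sum.distrib)
  qed (rule scale)
  then show thesis using assms(2) that unfolding T_def by blast
qed

text \<open>Convexity arguments on \<open>P\<close> involve points outside the lattice, so they need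
  real coefficients; \<open>root_lattice_real_cone\<close> restores integrality afterwards.\<close>

definition real_cone :: "'a \<Rightarrow> 'a set" where
  "real_cone p = {x. \<exists>c. (\<forall>\<alpha>\<in>simple p. c \<alpha> \<ge> 0) \<and> x = (\<Sum>\<alpha>\<in>simple p. c \<alpha> *\<^sub>R \<alpha>)}"

lemma qplus_real_cone: "qplus p \<subseteq> real_cone p"
proof
  fix x assume "x \<in> qplus p"
  then obtain c :: "'a \<Rightarrow> nat" where "x = (\<Sum>\<alpha>\<in>simple p. real (c \<alpha>) *\<^sub>R \<alpha>)"
    unfolding qplus_def by blast
  then show "x \<in> real_cone p"
    unfolding real_cone_def by (intro CollectI exI[of _ "\<lambda>\<alpha>. real (c \<alpha>)"]) simp
qed

lemma real_cone_combine:
  assumes "x \<in> real_cone p" "y \<in> real_cone p" "a \<ge> 0" "b \<ge> 0"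
  shows "a *\<^sub>R x + b *\<^sub>R y \<in> real_cone p"
proof -
  obtain c d where "\<forall>\<alpha>\<in>simple p. c \<alpha> \<ge> 0" "x = (\<Sum>\<alpha>\<in>simple p. c \<alpha> *\<^sub>R \<alpha>)"
    "\<forall>\<alpha>\<in>simple p. d \<alpha> \<ge> 0" "y = (\<Sum>\<alpha>\<in>simple p. d \<alpha> *\<^sub>R \<alpha>)"
    using assms(1,2) unfolding real_cone_def by blast
  then show ?thesis
    unfolding real_cone_def using assms(3,4)
    by (intro CollectI exI[of _ "\<lambda>\<alpha>. a * c \<alpha> + b * d \<alpha>"])
      (simp add: scaleR_add_left sum.distrib scaleR_sum_right)
qed

text \<open>Linear independence of the simple roots identifies the nonnegative real coefficients
  with the integral ones.\<close>

lemma root_lattice_real_cone: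
  assumes p: "regular p" and "x \<in> root_lattice \<Delta>" "x \<in> real_cone p"
  shows "x \<in> qplus p"
proof -
  obtain r where r: "\<forall>\<alpha>\<in>simple p. r \<alpha> \<ge> 0" "x = (\<Sum>\<alpha>\<in>simple p. r \<alpha> *\<^sub>R \<alpha>)"
    using assms(3) unfolding real_cone_def by blast
  obtain c :: "'a \<Rightarrow> int" where c: "x = (\<Sum>\<alpha>\<in>simple p. of_int (c \<alpha>) *\<^sub>R \<alpha>)"
    using root_lattice_simple_coefficients[OF p assms(2)] .
  have "c \<alpha> \<ge> 0" if "\<alpha> \<in> simple p" for \<alpha>
    using simple_coefficients_unique[OF p _ that, of r "\<lambda>\<alpha>. of_int (c \<alpha>)"] r c that by force
  then have "x = (\<Sum>\<alpha>\<in>simple p. real (nat (c \<alpha>)) *\<^sub>R \<alpha>)"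
    unfolding c by (intro sum.cong) auto
  then show ?thesis by (rule qplusI)
qed

lemma qplus_inner_nonneg:
  assumes "x \<in> qplus p" "\<And>\<alpha>. \<alpha> \<in> simple p \<Longrightarrow> \<alpha> \<bullet> y \<ge> 0"
  shows "x \<bullet> y \<ge> 0"
proof -
  obtain c :: "'a \<Rightarrow> nat" where "x = (\<Sum>\<alpha>\<in>simple p. real (c \<alpha>) *\<^sub>R \<alpha>)"
    using assms(1) unfolding qplus_def by blast
  then show ?thesis
    using assms(2) by (auto simp: inner_sum_left intro!: sum_nonneg mult_nonneg_nonneg)
qed

text \<open>If no simple root paired positively with \<gamma>, expanding \<gamma> in simple roots
  would give \<open>\<gamma> \<bullet> \<gamma> \<le> 0\<close>. The root found supplies the
  height-lowering reflection in \<open>min_tuples_pairing\<close>.\<close>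

lemma pos_simple_positive:
  assumes "\<gamma> \<in> pos p"
  obtains \<alpha> where "\<alpha> \<in> simple p" "\<gamma> \<bullet> \<alpha> > 0"
proof -
  have "\<gamma> \<bullet> (- \<gamma>) < 0" using pos_root[OF assms] root_nonzero by auto
  then show thesis
    using qplus_inner_nonneg[OF pos_qplus[OF assms], of "- \<gamma>"] that
    by (metis inner_commute inner_minus_right neg_0_le_iff_le not_le)
qed

section \<open>Decompositions of minimal energy\<close>

text \<open>Extensionality makes the set of tuples finite.\<close>

definition tuples :: "'a \<Rightarrow> 'a \<Rightarrow> nat \<Rightarrow> 'a \<Rightarrow> (nat \<Rightarrow> 'a) set" where
  "tuples p l m z = {w \<in> extensional {1..m}. (\<forall>i\<in>{1..m}. l - w i \<in> qplus p) \<and> (\<Sum>i=1..m. w i) = z}"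

definition energy :: "nat \<Rightarrow> (nat \<Rightarrow> 'a) \<Rightarrow> real" where
  "energy m w = (\<Sum>i=1..m. w i \<bullet> w i)"

definition min_tuples :: "'a \<Rightarrow> 'a \<Rightarrow> nat \<Rightarrow> 'a \<Rightarrow> (nat \<Rightarrow> 'a) set" where
  "min_tuples p l m z = {w \<in> tuples p l m z. \<forall>v\<in>tuples p l m z. energy m w \<le> energy m v}"

text \<open>Every simple root is positive at \<open>p\<close>, so a bound on the value at
  \<open>p\<close> bounds each coefficient separately.\<close>

lemma finite_bounded_qplus: "finite {v \<in> qplus p. v \<bullet> p \<le> K}"
proof (rule finite_subset)
  let ?B = "\<Pi>\<^sub>E \<alpha>\<in>simple p. {..nat \<lceil>K / (\<alpha> \<bullet> p)\<rceil>}"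
  show "finite ((\<lambda>c. \<Sum>\<alpha>\<in>simple p. real (c \<alpha>) *\<^sub>R \<alpha>) ` ?B)"
    using finite_simple by (intro finite_imageI finite_PiE) auto
  show "{v \<in> qplus p. v \<bullet> p \<le> K} \<subseteq> (\<lambda>c. \<Sum>\<alpha>\<in>simple p. real (c \<alpha>) *\<^sub>R \<alpha>) ` ?B"
  proof
    fix v assume "v \<in> {v \<in> qplus p. v \<bullet> p \<le> K}"
    then obtain c :: "'a \<Rightarrow> nat" where c: "v = (\<Sum>\<alpha>\<in>simple p. real (c \<alpha>) *\<^sub>R \<alpha>)" and K: "v \<bullet> p \<le> K"
      unfolding qplus_def by blast
    have ap: "\<alpha> \<bullet> p > 0" if "\<alpha> \<in> simple p" for \<alpha>
      using simple_pos[OF that] by (simp add: pos_def)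
    have "c \<alpha> \<le> nat \<lceil>K / (\<alpha> \<bullet> p)\<rceil>" if a: "\<alpha> \<in> simple p" for \<alpha>
    proof -
      have "real (c \<alpha>) * (\<alpha> \<bullet> p) \<le> (\<Sum>\<beta>\<in>simple p. real (c \<beta>) * (\<beta> \<bullet> p))"
        using less_imp_le[OF ap] finite_simple a by (intro member_le_sum mult_nonneg_nonneg) auto
      also have "\<dots> \<le> K" using K unfolding c by (simp add: inner_sum_left)
      finally have "real (c \<alpha>) \<le> K / (\<alpha> \<bullet> p)" using ap[OF a] by (simp add: field_simps)
      then show ?thesis by linarith
    qed
    then have "restrict c (simple p) \<in> ?B" by auto
    moreover have "v = (\<Sum>\<alpha>\<in>simple p. real (restrict c (simple p) \<alpha>) *\<^sub>R \<alpha>)"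
      unfolding c by (intro sum.cong) auto
    ultimately show "v \<in> (\<lambda>c. \<Sum>\<alpha>\<in>simple p. real (c \<alpha>) *\<^sub>R \<alpha>) ` ?B" by blast
  qed
qed

text \<open>The gaps \<open>l - w i\<close> have nonnegative values at \<open>p\<close> and sum to
  \<open>real m *\<^sub>R l - z\<close>; hence each single gap is bounded.\<close>

lemma finite_tuples: "finite (tuples p l m z)"
proof (rule finite_subset)
  define K where "K = (real m *\<^sub>R l - z) \<bullet> p"
  let ?B = "(\<lambda>v. l - v) ` {v \<in> qplus p. v \<bullet> p \<le> K}"
  show "finite (\<Pi>\<^sub>E i\<in>{1..m}. ?B)"
    using finite_bounded_qplus by (intro finite_PiE) auto
  show "tuples p l m z \<subseteq> (\<Pi>\<^sub>E i\<in>{1..m}. ?B)"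
  proof
    fix w assume w: "w \<in> tuples p l m z"
    have q: "l - w i \<in> qplus p" if "i \<in> {1..m}" for i
      using w that by (simp add: tuples_def)
    have nonneg: "(l - w i) \<bullet> p \<ge> 0" if "i \<in> {1..m}" for i
      using q[OF that] by (rule qplus_inner_nonneg) (auto dest: simple_pos simp: pos_def)
    have "w i \<in> ?B" if i: "i \<in> {1..m}" for i
    proof -
      have "(l - w i) \<bullet> p \<le> (\<Sum>i=1..m. (l - w i) \<bullet> p)"
        using nonneg i by (intro member_le_sum) auto
      also have "\<dots> = (\<Sum>i=1..m. l - w i) \<bullet> p" by (rule inner_sum_left[symmetric])
      also have "(\<Sum>i=1..m. l - w i) = real m *\<^sub>R l - z"
        using w by (simp add: tuples_def sum_subtractf sum_constant_scaleR)
      finally have "l - w i \<in> {v \<in> qplus p. v \<bullet> p \<le> K}" using q[OF i] by (simp add: K_def)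
      moreover have "w i = l - (l - w i)" by simp
      ultimately show ?thesis by blast
    qed
    then show "w \<in> (\<Pi>\<^sub>E i\<in>{1..m}. ?B)" using w by (auto simp: tuples_def PiE_def)
  qed
qed

lemma min_tuples_nonempty:
  assumes "m > 0" "real m *\<^sub>R l - z \<in> qplus p"
  shows "min_tuples p l m z \<noteq> {}"
proof -
  \<comment> \<open>One admissible tuple suffices: the whole deficit
    \<open>real m *\<^sub>R l - z\<close> is put into the first entry and all others equal
    \<open>l\<close>.\<close>
  define w where "w = (\<lambda>i\<in>{1..m}. if i = 1 then z - real (m - 1) *\<^sub>R l else l)"
  have "(\<Sum>i=1..m. w i) = w 1 + (\<Sum>i\<in>{1..m} - {1}. w i)"
    using assms(1) by (intro sum.remove) auto
  also have "(\<Sum>i\<in>{1..m} - {1}. w i) = (\<Sum>i\<in>{1..m} - {1}. l)"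
    by (intro sum.cong) (auto simp: w_def)
  finally have "(\<Sum>i=1..m. w i) = z"
    using assms(1) by (simp add: w_def sum_constant_scaleR)
  moreover have "l - w i \<in> qplus p" if "i \<in> {1..m}" for i
  proof (cases "i = 1")
    case True
    have "l - w i = real m *\<^sub>R l - z"
      using True that by (simp add: w_def of_nat_diff algebra_simps)
    then show ?thesis using assms(2) by simp
  qed (use that qplus_0 in \<open>simp add: w_def\<close>)
  ultimately have "w \<in> tuples p l m z" by (auto simp: tuples_def w_def)
  then obtain v where "is_arg_min (energy m) (\<lambda>v. v \<in> tuples p l m z) v"
    using ex_is_arg_min_if_finite[OF finite_tuples] by blast
  then show ?thesis by (auto simp: min_tuples_def is_arg_min_linorder)
qed

lemma min_tuples_exchange:
  assumes p: "regular p" and int: "\<forall>\<gamma>\<in>\<Delta>. l \<bullet> coroot \<gamma> \<in> \<int>"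
    and l: "\<forall>\<alpha>\<in>simple p. l \<bullet> coroot \<alpha> \<ge> 0"
    and z: "\<forall>\<alpha>\<in>simple p. z \<bullet> coroot \<alpha> \<ge> 0"
    and w: "w \<in> min_tuples p l m z" and j: "j \<in> {1..m}"
    and a: "\<alpha> \<in> simple p" and neg: "w j \<bullet> coroot \<alpha> < 0"
  shows "w j \<bullet> coroot \<alpha> = - 1"
    and "\<exists>v\<in>min_tuples p l m z. v j = root_reflection \<alpha> (w j)"
proof -
  have wt: "w \<in> tuples p l m z" and min: "\<And>v. v \<in> tuples p l m z \<Longrightarrow> energy m w \<le> energy m v"
    using w by (auto simp: min_tuples_def)
  have below: "l - w i \<in> qplus p" if "i \<in> {1..m}" for i
    using wt that by (simp add: tuples_def)
  \<comment> \<open>Integrality passes from \<open>l\<close> to \<open>w i\<close> because their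
    difference lies in the root lattice.\<close>
  have pairing: "w i \<bullet> coroot \<alpha> \<in> \<int>" if "i \<in> {1..m}" for i
    using Ints_diff[OF bspec[OF int simple_root[OF a]]
        root_lattice_pairing_int[OF qplus_root_lattice[OF below[OF that]] simple_root[OF a]]]
    by (simp add: inner_diff_left)
  have sum: "(\<Sum>i=1..m. w i) = z" using wt by (simp add: tuples_def)
  have nz: "\<alpha> \<bullet> \<alpha> > 0" using root_nonzero[OF simple_root[OF a]] by simp
  have negle: "w j \<bullet> coroot \<alpha> \<le> - 1"
    using Ints_le_add_one[OF pairing[OF j], of 0] neg by simp
  have "(\<Sum>i=1..m. w i \<bullet> coroot \<alpha>) \<ge> 0"
    using bspec[OF z a] unfolding sum[symmetric] inner_sum_left .
  moreover have "(\<Sum>i=1..m. w i \<bullet> coroot \<alpha>) = w j \<bullet> coroot \<alpha> + (\<Sum>i\<in>{1..m} - {j}. w i \<bullet> coroot \<alpha>)"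
    using j by (intro sum.remove) auto
  ultimately have "(\<Sum>i\<in>{1..m} - {j}. w i \<bullet> coroot \<alpha>) > 0" using neg by linarith
  then obtain k where k: "k \<in> {1..m}" "k \<noteq> j" and kpos: "w k \<bullet> coroot \<alpha> > 0"
    by (metis (no_types, lifting) DiffE insertI1 not_le sum_nonpos)
  have kge: "w k \<bullet> coroot \<alpha> \<ge> 1"
    using Ints_le_add_one[OF _ pairing[OF k(1)], of 0] kpos by simp
  define v where "v = w(j := w j + \<alpha>, k := w k - \<alpha>)"
  have v: "v j = w j + \<alpha>" "v k = w k - \<alpha>" "\<And>i. i \<noteq> j \<Longrightarrow> i \<noteq> k \<Longrightarrow> v i = w i"
    using k by (auto simp: v_def)
  \<comment> \<open>The type of the values is left general because the identity is applied both to
    vectors and to their squared lengths.\<close>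
  have split: "(\<Sum>i=1..m. f i) = f j + f k + (\<Sum>i\<in>{1..m} - {j} - {k}. f i)" for f :: "nat \<Rightarrow> 'b::ab_group_add"
  proof -
    have "(\<Sum>i=1..m. f i) = f j + (\<Sum>i\<in>{1..m} - {j}. f i)"
      using j by (intro sum.remove) auto
    also have "(\<Sum>i\<in>{1..m} - {j}. f i) = f k + (\<Sum>i\<in>{1..m} - {j} - {k}. f i)"
      using k by (intro sum.remove) auto
    finally show ?thesis by (simp add: add.assoc)
  qed
  have sumv: "(\<Sum>i=1..m. v i) = z"
    unfolding sum[symmetric] split[of v] split[of w] v by (simp add: v(3))
  have energy: "energy m v = energy m w + (\<alpha> \<bullet> \<alpha>) * (w j \<bullet> coroot \<alpha> - w k \<bullet> coroot \<alpha> + 2)"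
  proof -
    have "energy m v - energy m w
        = (w j + \<alpha>) \<bullet> (w j + \<alpha>) + (w k - \<alpha>) \<bullet> (w k - \<alpha>) - w j \<bullet> w j - w k \<bullet> w k"
      unfolding energy_def split[of "\<lambda>i. v i \<bullet> v i"] split[of "\<lambda>i. w i \<bullet> w i"] by (simp add: v)
    also have "\<dots> = 2 * (w j \<bullet> \<alpha>) - 2 * (w k \<bullet> \<alpha>) + 2 * (\<alpha> \<bullet> \<alpha>)"
      by (simp add: inner_add_left inner_add_right inner_diff_left inner_diff_right inner_commute)
    also have "\<dots> = (\<alpha> \<bullet> \<alpha>) * (w j \<bullet> coroot \<alpha> - w k \<bullet> coroot \<alpha> + 2)"
      using nz by (simp add: inner_coroot field_simps)
    finally show ?thesis by simp
  qed
  have "l - w j - \<alpha> \<in> qplus p"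
  proof -
    obtain c :: "'a \<Rightarrow> nat" where c: "l - w j = (\<Sum>\<beta>\<in>simple p. real (c \<beta>) *\<^sub>R \<beta>)"
      using below[OF j] unfolding qplus_def by blast
    \<comment> \<open>There is room to add \<alpha> to \<open>w j\<close>: without \<alpha> in its
      expansion, the gap would pair nonpositively with the coroot of \<alpha>, whereas
      \<open>l\<close> pairs nonnegatively and \<open>w j\<close> negatively.\<close>
    have "c \<alpha> \<noteq> 0"
    proof
      assume "c \<alpha> = 0"
      have "(l - w j) \<bullet> coroot \<alpha> = (\<Sum>\<beta>\<in>simple p. real (c \<beta>) * (\<beta> \<bullet> coroot \<alpha>))"
        unfolding c by (simp add: inner_sum_left)
      also have "\<dots> \<le> 0"
      proof (rule sum_nonpos)
        fix \<beta> assume "\<beta> \<in> simple p"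
        then show "real (c \<beta>) * (\<beta> \<bullet> coroot \<alpha>) \<le> 0"
          using simple_obtuse_coroot[OF p _ a] \<open>c \<alpha> = 0\<close>
          by (cases "\<beta> = \<alpha>") (auto intro: mult_nonneg_nonpos)
      qed
      finally show False using bspec[OF l a] neg by (simp add: inner_diff_left)
    qed
    have "l - w j - \<alpha> = real (c \<alpha>) *\<^sub>R \<alpha> - \<alpha> + (\<Sum>\<beta>\<in>simple p - {\<alpha>}. real (c \<beta>) *\<^sub>R \<beta>)"
      unfolding c using a finite_simple by (simp add: sum.remove)
    also have "real (c \<alpha>) *\<^sub>R \<alpha> - \<alpha> = real (c \<alpha> - 1) *\<^sub>R \<alpha>"
      using \<open>c \<alpha> \<noteq> 0\<close> by (simp add: of_nat_diff scaleR_diff_left)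
    finally show ?thesis
      using qplus_scale simple_qplus a by (auto intro!: qplus_add qplus_sum)
  qed
  moreover have "l - w k + \<alpha> \<in> qplus p"
    using below[OF k(1)] simple_qplus[OF a] qplus_add by blast
  moreover have "l - v j = l - w j - \<alpha>" "l - v k = l - w k + \<alpha>" by (simp_all add: v(1,2))
  ultimately have "l - v i \<in> qplus p" if "i \<in> {1..m}" for i
    using below[OF that] v(3)[of i] by metis
  moreover have "v \<in> extensional {1..m}"
    using wt j k by (auto simp: tuples_def v_def extensional_def)
  ultimately have vt: "v \<in> tuples p l m z" using sumv by (simp add: tuples_def)
  \<comment> \<open>Minimality makes the last factor nonnegative, while the integral bounds -1 for
    \<open>j\<close> and 1 for \<open>k\<close> make it at most zero. So both bounds are attained
    and the energy is unchanged.\<close>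
  have "(\<alpha> \<bullet> \<alpha>) * (w j \<bullet> coroot \<alpha> - w k \<bullet> coroot \<alpha> + 2) \<ge> 0"
    using min[OF vt] energy by simp
  then have ge: "w j \<bullet> coroot \<alpha> - w k \<bullet> coroot \<alpha> + 2 \<ge> 0"
    using nz by (simp add: zero_le_mult_iff)
  then show eq: "w j \<bullet> coroot \<alpha> = - 1" using negle kge by linarith
  have "energy m v = energy m w" using energy ge negle kge by simp
  then have "v \<in> min_tuples p l m z" using vt min by (simp add: min_tuples_def)
  moreover have "v j = root_reflection \<alpha> (w j)" using eq v by (simp add: root_reflection_def)
  ultimately show "\<exists>v\<in>min_tuples p l m z. v j = root_reflection \<alpha> (w j)" by blast
qed

text \<open>Height is measured by the number of positive roots with smaller value at
  \<open>p\<close>. The tuple varies in the induction because the reflected entry belongs to a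
  different minimal tuple.\<close>

lemma min_tuples_pairing:
  assumes p: "regular p" and int: "\<forall>\<gamma>\<in>\<Delta>. l \<bullet> coroot \<gamma> \<in> \<int>"
    and l: "\<forall>\<alpha>\<in>simple p. l \<bullet> coroot \<alpha> \<ge> 0"
    and z: "\<forall>\<alpha>\<in>simple p. z \<bullet> coroot \<alpha> \<ge> 0"
    and w: "w \<in> min_tuples p l m z" and j: "j \<in> {1..m}" and g: "\<gamma> \<in> pos p"
  shows "w j \<bullet> coroot \<gamma> \<ge> - 1"
  using w g
proof (induction "card {\<beta>\<in>pos p. \<beta> \<bullet> p < \<gamma> \<bullet> p}" arbitrary: \<gamma> w rule: less_induct)
  case less
  note exchange = min_tuples_exchange[OF p int l z less.prems(1) j]
  show ?case
  proof (cases "\<gamma> \<in> simple p")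
    case True
    then show ?thesis using exchange(1)[OF True] by force
  next
    case False
    obtain \<alpha> where a: "\<alpha> \<in> simple p" and ga: "\<gamma> \<bullet> \<alpha> > 0"
      using pos_simple_positive[OF less.prems(2)] .
    have "\<gamma> \<noteq> \<alpha>" using False a by blast
    have nz: "\<alpha> \<bullet> \<alpha> > 0" using root_nonzero[OF simple_root[OF a]] by simp
    define \<gamma>' where "\<gamma>' = root_reflection \<alpha> \<gamma>"
    have g': "\<gamma>' \<in> pos p"
      unfolding \<gamma>'_def by (rule reflection_pos[OF p a less.prems(2) \<open>\<gamma> \<noteq> \<alpha>\<close>])
    have "(\<gamma> \<bullet> coroot \<alpha>) * (\<alpha> \<bullet> p) > 0"
      using ga nz simple_pos[OF a] by (simp add: inner_coroot pos_def)
    then have lt: "\<gamma>' \<bullet> p < \<gamma> \<bullet> p"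
      by (simp add: \<gamma>'_def root_reflection_def inner_diff_left)
    have "{\<beta>\<in>pos p. \<beta> \<bullet> p < \<gamma>' \<bullet> p} \<subset> {\<beta>\<in>pos p. \<beta> \<bullet> p < \<gamma> \<bullet> p}"
      using lt g' by force
    then have "card {\<beta>\<in>pos p. \<beta> \<bullet> p < \<gamma>' \<bullet> p} < card {\<beta>\<in>pos p. \<beta> \<bullet> p < \<gamma> \<bullet> p}"
      using finite_pos by (intro psubset_card_mono) auto
    note IH = less.hyps[OF this _ g']
    have pairing': "x \<bullet> coroot \<gamma>' = root_reflection \<alpha> x \<bullet> coroot \<gamma>" for x
      by (simp add: \<gamma>'_def coroot_root_reflection root_reflection_inner)
    show ?thesis
    proof (cases "w j \<bullet> coroot \<alpha> < 0")
      case True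
      obtain v where v: "v \<in> min_tuples p l m z" "v j = root_reflection \<alpha> (w j)"
        using exchange(2)[OF a True] by blast
      then show ?thesis using IH[OF v(1)] by (simp add: pairing')
    next
      case False
      \<comment> \<open>Here the pairing with the lower root \<gamma>' is at most the one with
        \<gamma>, so the bound carries over with the same tuple.\<close>
      have "w j \<bullet> coroot \<gamma>' = w j \<bullet> coroot \<gamma> - (w j \<bullet> coroot \<alpha>) * (\<alpha> \<bullet> coroot \<gamma>)"
        unfolding pairing' by (simp add: root_reflection_def inner_diff_left)
      moreover have "(w j \<bullet> coroot \<alpha>) * (\<alpha> \<bullet> coroot \<gamma>) \<ge> 0"
        using False ga by (intro mult_nonneg_nonneg) (auto simp: inner_coroot inner_commute)
      ultimately show ?thesis using IH[OF less.prems(1)] by linarith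
    qed
  qed
qed

end

section \<open>Special ample polytopes\<close>

locale special_ample = reduced_root_system +
  fixes P :: "'a set" and \<mu> :: "'a set \<Rightarrow> 'a"
  assumes special_ample: "special_ample_polytope \<Delta> P \<mu>"
begin

lemma ample: "ample_polytope \<Delta> P \<mu>"
  using special_ample by (simp add: special_ample_polytope_def)

lemma polytope_P: "polytope P"
  using ample by (simp add: ample_polytope_def)

lemma vertex_weight: "regular q \<Longrightarrow> \<mu> (chamber q) \<in> weight_lattice \<Delta>"
  using ample chamber_in_chambers by (auto simp: ample_polytope_def)

lemma P_hull: "P = convex hull (\<mu> ` chambers \<Delta>)"
  using Krein_Milman_Minkowski[OF polytope_imp_compact polytope_imp_convex, OF polytope_P polytope_P] ample
  unfolding ample_polytope_def by argo

lemma vertex_dominant: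
  assumes "regular q" "\<delta> \<in> simple q"
  shows "\<mu> (chamber q) \<bullet> coroot \<delta> \<ge> 0"
  using special_ample chamber_in_chambers[OF assms(1)] assms simple_roots_chamber
  by (auto simp: special_ample_polytope_def dominant_def)

lemma vertex_step:
  assumes q: "regular q" and d: "\<delta> \<in> simple q"
  obtains n :: nat where "\<mu> (chamber q) - \<mu> (chamber (root_reflection \<delta> q)) = real n *\<^sub>R \<delta>"
proof -
  have "regular (root_reflection \<delta> q)" using regular_reflection[OF q simple_root[OF d]] .
  then obtain r :: int where "r > 0"
    "\<mu> (chamber q) - \<mu> (chamber (root_reflection \<delta> q)) = of_int r *\<^sub>R \<delta>"
    using ample adjacent_reflection[OF q d] chamber_in_chambers q
    unfolding ample_polytope_def by metis
  then show thesis using that[of "nat r"] by simp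
qed

text \<open>Along a gallery starting at \<open>p\<close>, each crossing subtracts from the vertex a
  nonnegative multiple of a root positive at \<open>p\<close>.\<close>

lemma vertex_below:
  assumes p: "regular p" and q: "regular q"
  shows "\<mu> (chamber p) - \<mu> (chamber q) \<in> qplus p"
  using p q
proof (induction rule: gallery_induct)
  case (step q \<delta>)
  obtain n :: nat where "\<mu> (chamber q) - \<mu> (chamber (root_reflection \<delta> q)) = real n *\<^sub>R \<delta>"
    using vertex_step[OF step.hyps(1,2)] .
  then have "\<mu> (chamber p) - \<mu> (chamber (root_reflection \<delta> q))
      = (\<mu> (chamber p) - \<mu> (chamber q)) + real n *\<^sub>R \<delta>"
    by (simp add: algebra_simps)
  then show ?case using step qplus_add qplus_scale pos_qplus by metis
qed (simp add: qplus_0)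

text \<open>The condition is convex in \<open>x\<close> and holds at all vertices, whose hull is
  \<open>P\<close>.\<close>

lemma P_below:
  assumes p: "regular p" and x: "x \<in> P"
  shows "\<mu> (chamber p) - x \<in> real_cone p"
proof -
  have "P \<subseteq> {x. \<mu> (chamber p) - x \<in> real_cone p}"
    unfolding P_hull
  proof (rule hull_minimal)
    show "\<mu> ` chambers \<Delta> \<subseteq> {x. \<mu> (chamber p) - x \<in> real_cone p}"
    proof (safe)
      fix \<tau> assume "\<tau> \<in> chambers \<Delta>"
      then show "\<mu> (chamber p) - \<mu> \<tau> \<in> real_cone p"
        using vertex_below[OF p] qplus_real_cone by (metis chambers_cases subsetD)
    qed
    show "convex {x. \<mu> (chamber p) - x \<in> real_cone p}"
    proof (rule convexI)
      fix x y and u v :: real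
      assume *: "x \<in> {x. \<mu> (chamber p) - x \<in> real_cone p}" "y \<in> {x. \<mu> (chamber p) - x \<in> real_cone p}"
        "0 \<le> u" "0 \<le> v" "u + v = 1"
      have "\<mu> (chamber p) - (u *\<^sub>R x + v *\<^sub>R y)
          = (u + v) *\<^sub>R \<mu> (chamber p) - (u *\<^sub>R x + v *\<^sub>R y)"
        using * by simp
      also have "\<dots> = u *\<^sub>R (\<mu> (chamber p) - x) + v *\<^sub>R (\<mu> (chamber p) - y)"
        by (simp add: algebra_simps)
      finally show "u *\<^sub>R x + v *\<^sub>R y \<in> {x. \<mu> (chamber p) - x \<in> real_cone p}"
        using * real_cone_combine by simp
    qed
  qed
  then show ?thesis using x by blast
qed

text \<open>A partial converse of \<open>P_below\<close>. If a functional \<open>a\<close> separated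
  \<open>x\<close> from \<open>P\<close>, the vertex of a chamber containing \<open>- a\<close>
  would have an \<open>a\<close>-value no larger than that of \<open>x\<close>, a
  contradiction.\<close>

lemma below_vertices_mem:
  assumes below: "\<And>q. regular q \<Longrightarrow> \<mu> (chamber q) - x \<in> qplus q"
  shows "x \<in> P"
proof (rule ccontr)
  assume "x \<notin> P"
  then obtain a b where ab: "a \<bullet> x < b" "\<forall>y\<in>P. a \<bullet> y > b"
    using separating_hyperplane_closed_point[of P x] polytope_P polytope_imp_convex polytope_imp_closed
    by blast
  obtain q where q: "regular q" "\<And>\<alpha>. \<alpha> \<in> pos q \<Longrightarrow> \<alpha> \<bullet> (- a) \<ge> 0"
    using exists_regular_near by blast
  have "\<mu> (chamber q) \<in> P"
    unfolding P_hull using chamber_in_chambers[OF q(1)] by (intro hull_inc) simp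
  then have "a \<bullet> \<mu> (chamber q) > b" using ab(2) by blast
  moreover have "(\<mu> (chamber q) - x) \<bullet> (- a) \<ge> 0"
    by (rule qplus_inner_nonneg[OF below[OF q(1)] q(2)[OF simple_pos]])
  then have "a \<bullet> \<mu> (chamber q) \<le> a \<bullet> x"
    by (simp add: inner_diff_left inner_diff_right inner_commute)
  ultimately show False using ab(1) by linarith
qed

lemma near_dominant_below:
  assumes p: "regular p" and below: "\<mu> (chamber p) - x \<in> qplus p"
    and near: "\<And>\<gamma>. \<gamma> \<in> pos p \<Longrightarrow> x \<bullet> coroot \<gamma> \<ge> - 1"
    and q: "regular q"
  shows "\<mu> (chamber q) - x \<in> qplus q"
proof -
  \<comment> \<open>Points of the same chamber share \<open>qplus\<close>, so the statement is phrased in terms of the chamber.\<close>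
  define Q where "Q \<sigma> \<longleftrightarrow> (\<forall>q. regular q \<longrightarrow> chamber q = \<sigma> \<longrightarrow> \<mu> \<sigma> - x \<in> qplus q)" for \<sigma>
  have same: "qplus q = qplus q'" if "regular q" "regular q'" "chamber q = chamber q'" for q q'
    using simple_roots_chamber[OF that(1)] simple_roots_chamber[OF that(2)] that(3)
    by (simp add: qplus_def)
  have "Q (chamber q)"
    using p q
  proof (induction rule: gallery_induct)
    case base
    then show ?case using below same[OF p] by (auto simp: Q_def)
  next
    case (step q \<delta>)
    note q = step.hyps(1) and d = step.hyps(2)
    have D: "\<delta> \<in> \<Delta>" using simple_root[OF d] .
    have nz: "\<delta> \<noteq> 0" using root_nonzero[OF D] .
    define r where "r = root_reflection \<delta> q"
    have r: "regular r" and dr: "- \<delta> \<in> simple r"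
      unfolding r_def using regular_reflection[OF q D] minus_simple_reflection[OF d] by auto
    obtain c :: "'a \<Rightarrow> nat" where c: "\<mu> (chamber q) - x = (\<Sum>\<alpha>\<in>simple q. real (c \<alpha>) *\<^sub>R \<alpha>)"
      using step q unfolding Q_def qplus_def by blast
    obtain n :: nat where n: "\<mu> (chamber q) - \<mu> (chamber r) = real n *\<^sub>R \<delta>"
      unfolding r_def using vertex_step[OF q d] .
    \<comment> \<open>Each \<alpha> in \<open>S\<close> is replaced by its reflection, which is
      positive at \<open>r\<close>, plus a multiple of \<delta>. The sum of the reflections is
      \<open>s\<close>, the correction is \<open>e\<close>, and \<open>t\<close> collects the full
      coefficient of \<delta>, including the shift \<open>n\<close> of the vertex.\<close>
    define S where "S = simple q - {\<delta>}"
    define s where "s = (\<Sum>\<alpha>\<in>S. real (c \<alpha>) *\<^sub>R root_reflection \<delta> \<alpha>)"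
    define e where "e = (\<Sum>\<alpha>\<in>S. real (c \<alpha>) * (\<alpha> \<bullet> coroot \<delta>))"
    define t where "t = real (c \<delta>) - real n + e"
    have "\<mu> (chamber r) - x = (\<mu> (chamber q) - x) - real n *\<^sub>R \<delta>"
      using n by (simp add: algebra_simps)
    also have "\<mu> (chamber q) - x = real (c \<delta>) *\<^sub>R \<delta> + (\<Sum>\<alpha>\<in>S. real (c \<alpha>) *\<^sub>R \<alpha>)"
      unfolding c S_def using d finite_simple by (intro sum.remove) auto
    also have "(\<Sum>\<alpha>\<in>S. real (c \<alpha>) *\<^sub>R \<alpha>) = s + e *\<^sub>R \<delta>"
      unfolding s_def e_def
      by (simp add: root_reflection_def scaleR_diff_right sum_subtractf scaleR_sum_left)
    finally have eq: "\<mu> (chamber r) - x = s + t *\<^sub>R \<delta>"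
      by (simp add: t_def algebra_simps)
    have "e \<le> 0"
      unfolding e_def S_def using simple_obtuse_coroot[OF q _ d]
      by (intro sum_nonpos mult_nonneg_nonpos) auto
    have "s \<bullet> coroot \<delta> = - e"
      using nz unfolding s_def e_def
      by (simp add: inner_sum_left root_reflection_inner root_reflection_self
          flip: coroot_root_reflection sum_negf)
    then have "(\<mu> (chamber r) - x) \<bullet> coroot \<delta> = - e + 2 * t"
      unfolding eq inner_add_left inner_scaleR_left using nz by (simp add: inner_coroot[of \<delta>])
    moreover have "\<mu> (chamber r) \<bullet> coroot \<delta> \<le> 0"
      using vertex_dominant[OF r dr] by simp
    \<comment> \<open>Since \<delta> is positive at the starting point \<open>p\<close>,
      near-dominance applies to it. With the new vertex pairing nonpositively,
      \<open>2 * t - e \<le> 1\<close>, and \<open>e \<le> 0\<close>.\<close>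
    ultimately have "2 * t \<le> 1"
      using near[OF step.hyps(3)] \<open>e \<le> 0\<close> by (simp add: inner_diff_left)
    moreover have "t \<in> \<int>"
      unfolding t_def e_def S_def using coroot_int[OF D simple_root]
      by (intro Ints_add Ints_diff Ints_sum Ints_mult) auto
    ultimately have "t \<le> 0" using Ints_le_add_one[of t 1] by simp
    obtain k where k: "t = of_int k" using \<open>t \<in> \<int>\<close> by (rule Ints_cases)
    have "s \<in> qplus r"
      unfolding s_def
    proof (intro qplus_sum qplus_scale pos_qplus)
      fix \<alpha> assume "\<alpha> \<in> S"
      then show "root_reflection \<delta> \<alpha> \<in> pos r"
        unfolding r_def pos_reflection_iff[OF D] root_reflection_involution
        by (intro simple_pos) (simp add: S_def)
    qed
    \<comment> \<open>As \<open>t \<le> 0\<close>, the remaining term is a natural multiple of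
      \<open>- \<delta>\<close>, which is simple for \<open>r\<close>.\<close>
    moreover have "t *\<^sub>R \<delta> = real (nat (- k)) *\<^sub>R (- \<delta>)"
      using \<open>t \<le> 0\<close> k by simp
    ultimately have "\<mu> (chamber r) - x \<in> qplus r"
      unfolding eq using qplus_add qplus_scale simple_qplus[OF dr] by metis
    then show ?case
      using same[OF r] unfolding Q_def r_def by metis
  qed
  then show ?thesis using q by (simp add: Q_def)
qed

lemma dilation_decomposition:
  assumes \<sigma>: "\<sigma> \<in> chambers \<Delta>" and m: "m > 0"
    and z: "z \<in> Lambda \<Delta> ((\<lambda>x. real m *\<^sub>R x) ` P) (\<lambda>\<tau>. real m *\<^sub>R \<mu> \<tau>) \<sigma>"
  shows "\<exists>w :: nat \<Rightarrow> 'a. (\<forall>i\<in>{1..m}. w i \<in> Lambda \<Delta> P \<mu> \<sigma>) \<and> z = (\<Sum>i=1..m. w i)"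
proof -
  obtain s where s: "regular s" "\<sigma> = chamber s" using chambers_cases[OF \<sigma>] .
  obtain p where p: "regular p" "\<And>\<alpha>. \<alpha> \<in> pos p \<Longrightarrow> \<alpha> \<bullet> z \<ge> 0"
    using exists_regular_near by blast
  define l where "l = \<mu> (chamber p)"
  obtain x y where x: "x \<in> P" "z = real m *\<^sub>R x" and y: "y \<in> root_lattice \<Delta>" "z = real m *\<^sub>R \<mu> \<sigma> + y"
    using z unfolding Lambda_def by blast
  have ls: "l - \<mu> \<sigma> \<in> root_lattice \<Delta>"
    unfolding l_def s(2) using vertex_below[OF p(1) s(1)] by (rule qplus_root_lattice)
  \<comment> \<open>The representation by \<open>y\<close> gives membership in the root lattice, the
    one by \<open>x\<close> membership in the real cone.\<close>
  have "real m *\<^sub>R l - z \<in> qplus p"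
  proof (rule root_lattice_real_cone[OF p(1)])
    have "real m *\<^sub>R l - z = of_int (int m) *\<^sub>R (l - \<mu> \<sigma>) - y"
      using y(2) by (simp add: algebra_simps)
    then show "real m *\<^sub>R l - z \<in> root_lattice \<Delta>"
      using root_lattice_diff root_lattice_scale ls y(1) by metis
    have "real m *\<^sub>R l - z = real m *\<^sub>R (l - x) + 0 *\<^sub>R (l - x)"
      using x(2) by (simp add: algebra_simps)
    then show "real m *\<^sub>R l - z \<in> real_cone p"
      using real_cone_combine P_below[OF p(1) x(1)] l_def by (metis of_nat_0_le_iff order_refl)
  qed
  then obtain w where w: "w \<in> min_tuples p l m z"
    using min_tuples_nonempty[OF m] by blast
  have below: "l - w i \<in> qplus p" if "i \<in> {1..m}" for i
    using w that by (simp add: min_tuples_def tuples_def)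
  have near: "w i \<bullet> coroot \<gamma> \<ge> - 1" if "i \<in> {1..m}" "\<gamma> \<in> pos p" for i \<gamma>
  proof (rule min_tuples_pairing[OF p(1) _ _ _ w that])
    show "\<forall>\<gamma>\<in>\<Delta>. l \<bullet> coroot \<gamma> \<in> \<int>"
      unfolding l_def using weight_pairing_int[OF vertex_weight[OF p(1)]] by blast
    show "\<forall>\<alpha>\<in>simple p. l \<bullet> coroot \<alpha> \<ge> 0"
      unfolding l_def using vertex_dominant[OF p(1)] by blast
    show "\<forall>\<alpha>\<in>simple p. z \<bullet> coroot \<alpha> \<ge> 0"
      using p(2) simple_pos by (auto simp: inner_coroot inner_commute)
  qed
  have "w i \<in> Lambda \<Delta> P \<mu> \<sigma>" if i: "i \<in> {1..m}" for i
  proof -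
    have "w i \<in> P"
      using near_dominant_below[OF p(1)] below[OF i] near[OF i] unfolding l_def
      by (intro below_vertices_mem) blast
    \<comment> \<open>The base vertex changes from the chamber of \<open>p\<close>, adapted to
      \<open>z\<close>, to the given \<sigma>; vertices differ by root lattice elements.\<close>
    moreover have "w i = \<mu> \<sigma> + ((l - \<mu> \<sigma>) - (l - w i))" by simp
    moreover have "(l - \<mu> \<sigma>) - (l - w i) \<in> root_lattice \<Delta>"
      using root_lattice_diff[OF ls qplus_root_lattice[OF below[OF i]]] .
    ultimately show ?thesis unfolding Lambda_def by blast
  qed
  moreover have "z = (\<Sum>i=1..m. w i)"
    using w by (simp add: min_tuples_def tuples_def)
  ultimately show ?thesis by blast
qed

end

theorem theorem1p1:
  fixes \<Delta> P :: "'a::euclidean_space set"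
    and \<mu> :: "'a set \<Rightarrow> 'a" and \<sigma> :: "'a set" and m :: nat and z :: 'a
  assumes "root_system \<Delta>" and "reduced_roots \<Delta>" and "irreducible_roots \<Delta>"
    and "special_ample_polytope \<Delta> P \<mu>"
    and "\<sigma> \<in> chambers \<Delta>"
    and "m > 0"
    and "z \<in> Lambda \<Delta> ((\<lambda>x. real m *\<^sub>R x) ` P) (\<lambda>\<tau>. real m *\<^sub>R \<mu> \<tau>) \<sigma>"
  shows "\<exists>w :: nat \<Rightarrow> 'a. (\<forall>i\<in>{1..m}. w i \<in> Lambda \<Delta> P \<mu> \<sigma>) \<and> z = (\<Sum>i=1..m. w i)"
proof -
  interpret special_ample \<Delta> P \<mu>
    using assms(1,2,4) by unfold_locales
  show ?thesis using dilation_decomposition[OF assms(5-7)] .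
qed

end
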